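(* Let $p_-<0<p_+$ and $\lambda_-,\lambda_+>0$. Let $(X,E)$ be the piecewise deterministic process on $\mathbb{R}\times I$, $I=\{-1,1\}$, obtained by switching between $f_{-1}(x)=p_-x+x^3$ and $f_1(x)=p_+x+x^3$, with constant rate $\lambda_-$ of switching from $f_{-1}$ to $f_1$ and constant rate $\lambda_+$ of switching from $f_1$ to $f_{-1}$. Let $\nu$ be a probability measure on $\mathbb{R}\times I$ with $\nu((0,\infty)\times I)=1$. For $a>\sqrt{-p_-}$ let $\tau_a=\inf\{t\ge0:X_t\ge a\}$, and let $\nu\mathsf{P}^{\tau_a}$ denote the law of $(X,E)$ with initial distribution $\nu$ and stopped at time $\tau_a$. Then: 1. There is a nonincreasing function $g:[\sqrt{-p_-}+2,\infty)\to(0,\infty)$ with $\int_{\sqrt{-p_-}+2}^{\infty}g(a)\,da<\infty$ such that for every $a\ge\sqrt{-p_-}+2$, $$\nu\mathsf{P}^{\tau_a}\left(\tau_{\sqrt{-p_-}+1}<\infty\right)>0\qquad\text{and}\qquad\nu\mathsf{P}^{\tau_a}\left(\tau_a-\tau_{a-1}<g(a)\;\middle|\;\tau_{\sqrt{-p_-}+1}<\infty\right)=1.$$ 2. If $\frac{\lambda_+}{p_+}<-\frac{\lambda_-}{p_-}$, then $\nu\mathsf{P}^{\tau_a}(\tau_{\sqrt{-p_-}+1}<\infty)=1$ for every $a\ge\sqrt{-p_-}+2$. 3. If $\frac{\lambda_+}{p_+}>-\frac{\lambda_-}{p_-}$ and $\nu((0,\sqrt{-p_-})\times I)>0$, then for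 every $a\ge\sqrt{-p_-}+2$ we have $\nu\mathsf{P}^{\tau_a}(\tau_{\sqrt{-p_-}+1}<\infty)<1$ and $$\nu\mathsf{P}^{\tau_a}\left(\{\tau_{\sqrt{-p_-}+1}<\infty\}\cup\left\{\lim_{t\to\infty}X_t=0\right\}\right)=1.$$
   Context: The process $(X,E)$: $E=(E_t)_{t\ge0}$ is the continuous-time Markov chain on $I=\{-1,1\}$ that jumps from $-1$ to $1$ at rate $\lambda_-$ and from $1$ to $-1$ at rate $\lambda_+$ (rates independent of $X$), and $X$ solves $X_t=X_0+\int_0^t f_{E_s}(X_s)\,ds$. The vector fields are not forward complete (trajectories may blow up in finite time), but for initial positions in $(0,\infty)$ the process $(X,E)$ stopped at $\tau_a$, i.e. $(X_{t\wedge\tau_a},E_{t\wedge\tau_a})_{t\ge0}$, is well defined for all times. Convention: $\inf\emptyset=\infty$. *)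

theory Defs
  imports "HOL-Probability.Probability"
begin

text \<open>The parameters \<open>pm, pp, lm, lp\<close> stand for \<open>p\<^sub>-, p\<^sub>+, \<lambda>\<^sub>-, \<lambda>\<^sub>+\<close>;
  the discrete component takes values in \<open>I = {-1, 1}\<close>.\<close>

definition state_space :: "(real \<times> int) measure" where
  "state_space = borel \<Otimes>\<^sub>M count_space {-1, 1}"

definition vfield :: "real \<Rightarrow> real \<Rightarrow> int \<Rightarrow> real \<Rightarrow> real" where
  "vfield pm pp i x = (if i = 1 then pp else pm) * x + x ^ 3"

text \<open>Rate of leaving the state \<open>i\<close>.\<close>

definition rate :: "real \<Rightarrow> real \<Rightarrow> int \<Rightarrow> real" where
  "rate lm lp i = (if i = 1 then lp else lm)"

definition hitting_time :: "(real \<Rightarrow> real) \<Rightarrow> real \<Rightarrow> ereal" where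
  "hitting_time x b = Inf (ereal ` {t. 0 \<le> t \<and> b \<le> x t})"

text \<open>The time of the \<open>n\<close>-th jump of the chain started in \<open>i\<close>. The state visited after \<open>k\<close> jumps is
  \<open>(-1) ^ k * i\<close>; the time spent there is the standard exponential variable \<open>\<xi> k\<close> divided by the
  rate of leaving that state, i.e. an exponential variable with that rate.\<close>

definition jump_time :: "real \<Rightarrow> real \<Rightarrow> int \<Rightarrow> (nat \<Rightarrow> real) \<Rightarrow> nat \<Rightarrow> real" where
  "jump_time lm lp i \<xi> n = (\<Sum>k<n. \<xi> k / rate lm lp ((-1) ^ k * i))"

text \<open>\<open>E\<close> is the continuous-time Markov chain with these rates, described by its jump chain and
  holding times. The equation between laws says that \<open>(X\<^sub>0, E\<^sub>0)\<close> has law \<open>\<nu>\<close>, that the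
  \<open>\<xi> n\<close> are i.i.d. standard exponential, and that the sequence \<open>\<xi>\<close> is independent of
  \<open>(X\<^sub>0, E\<^sub>0)\<close>. The jump times almost surely tend to infinity, so that the last clause
  determines \<open>E\<^sub>t\<close> for all \<open>t \<ge> 0\<close> almost surely.\<close>

definition switching_chain ::
  "real \<Rightarrow> real \<Rightarrow> (real \<times> int) measure \<Rightarrow> 'w measure \<Rightarrow> ('w \<Rightarrow> real) \<Rightarrow> (real \<Rightarrow> 'w \<Rightarrow> int) \<Rightarrow> bool"
where
  "switching_chain lm lp \<nu> M X0 E \<longleftrightarrow>
     (\<forall>t\<ge>0. E t \<in> measurable M (count_space {-1, 1})) \<and>
     (\<exists>\<xi> :: nat \<Rightarrow> 'w \<Rightarrow> real.
        X0 \<in> borel_measurable M \<and>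
        (\<forall>n. \<xi> n \<in> borel_measurable M) \<and>
        distr M (state_space \<Otimes>\<^sub>M Pi\<^sub>M UNIV (\<lambda>_. borel)) (\<lambda>\<omega>. ((X0 \<omega>, E 0 \<omega>), \<lambda>n. \<xi> n \<omega>)) =
          \<nu> \<Otimes>\<^sub>M Pi\<^sub>M UNIV (\<lambda>_. density lborel (\<lambda>x. ennreal (exponential_density 1 x))) \<and>
        (AE \<omega> in M. \<forall>t\<ge>0. \<forall>n.
           jump_time lm lp (E 0 \<omega>) (\<lambda>k. \<xi> k \<omega>) n \<le> t \<and>
           t < jump_time lm lp (E 0 \<omega>) (\<lambda>k. \<xi> k \<omega>) (Suc n) \<longrightarrow>
           E t \<omega> = (-1) ^ n * E 0 \<omega>))"

text \<open>\<open>X\<close> is the position component stopped at \<open>\<tau>\<^sub>a\<close>, i.e. the continuous process solving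
  \<open>X\<^sub>t = X\<^sub>0 + \<integral>\<^sub>0\<^bsup>min t \<tau>\<^sub>a\<^esup> f\<^bsub>E\<^sub>s\<^esub>(X\<^sub>s) ds\<close> for all \<open>t \<ge> 0\<close>, where \<open>\<tau>\<^sub>a\<close> is the hitting time
  of \<open>[a, \<infinity>)\<close> by \<open>X\<close> itself. In this way the possible blow-up of the unstopped position never enters.
  The chain \<open>E\<close> is autonomous and is kept unstopped. Paths are continuous
  for every \<open>\<omega>\<close>, whereas the equation is only required almost surely (\<open>\<nu>\<close> may have initial positions
  outside \<open>(0, \<infinity>)\<close> on a null set).\<close>

definition stopped_switching_process ::
  "real \<Rightarrow> real \<Rightarrow> real \<Rightarrow> real \<Rightarrow> (real \<times> int) measure \<Rightarrow> real \<Rightarrow>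
   'w measure \<Rightarrow> (real \<Rightarrow> 'w \<Rightarrow> real) \<Rightarrow> (real \<Rightarrow> 'w \<Rightarrow> int) \<Rightarrow> bool"
where
  "stopped_switching_process pm pp lm lp \<nu> a M X E \<longleftrightarrow>
     prob_space M \<and>
     switching_chain lm lp \<nu> M (X 0) E \<and>
     (\<forall>t\<ge>0. X t \<in> borel_measurable M) \<and>
     (\<forall>\<omega>\<in>space M. continuous_on {0..} (\<lambda>t. X t \<omega>)) \<and>
     (AE \<omega> in M. \<forall>t\<ge>0.
        ((\<lambda>s. vfield pm pp (E s \<omega>) (X s \<omega>)) has_integral (X t \<omega> - X 0 \<omega>))
          {0 .. real_of_ereal (min (ereal t) (hitting_time (\<lambda>s. X s \<omega>) a))})"

end

theory Submission
  imports Defs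
begin

text \<open>The equation \<open>x' = p x + x\<^sup>3\<close> is a Bernoulli equation, linear in \<open>x\<^bsup>-2\<^esup>\<close>. If \<open>A\<^sub>t\<close> denotes the integral
  of \<open>p\<close> along the chain up to time \<open>t\<close>, then
  \<open>exp (2 A\<^sub>t) / X\<^sub>t\<^sup>2 = 1 / X\<^sub>0\<^sup>2 - J\<^sub>t\<close>, where \<open>J\<^sub>t\<close> is the integral of \<open>2 exp (2 A)\<close> over \<open>[0, t]\<close>.
  So the fate of the path is decided by comparing \<open>1 / X\<^sub>0\<^sup>2\<close> with the total integral \<open>J\<close>: the position
  passes the level if \<open>J > 1 / X\<^sub>0\<^sup>2\<close> and tends to \<open>0\<close> if \<open>J < 1 / X\<^sub>0\<^sup>2\<close>. At the jump times \<open>A\<close> is a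
  random walk. If its mean drift is positive, then \<open>J = \<infinity>\<close>; if it is negative, then \<open>J\<close> is finite.
  Conditioning on the first holding time shows that \<open>J\<close> then has no atoms and exceeds
  or undercuts every admissible level with positive probability.\<close>

section \<open>Hitting times and the Bernoulli equation\<close>

text \<open>Over one cycle of the chain, \<open>A\<close> gains \<open>pp\<close> and
  \<open>pm\<close> times holding times of means \<open>1 / lp\<close> and \<open>1 / lm\<close>. So
  the mean drift has the sign of \<open>pp / lp + pm / lm\<close>, and this sign is what the
  comparison of \<open>lp / pp\<close> with \<open>- (lm / pm)\<close> expresses. The level
  \<open>sqrt (- pm)\<close> is the positive equilibrium of the field of the state -1. On the side
  of the integral, a chain that stays in -1 for ever adds exactly
  \<open>exp (2 * A) / (- pm)\<close>, and any continuation with \<open>A\<close> tending to minus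
  infinity adds at least that. Above the equilibrium this minimal amount already exceeds
  \<open>exp (2 * A) / X\<^sup>2\<close>. From a start below it,
  \<open>1 / X\<^sub>0\<^sup>2\<close> lies above \<open>- 1 / pm\<close>, and a long first stay in
  -1 brings the total integral close to \<open>- 1 / pm\<close>. The obstacle in the dichotomy is
  the borderline case of equality with \<open>1 / X\<^sub>0\<^sup>2\<close>, which decides nothing;
  this is why the absence of atoms is needed. The bound on passage times is independent of the
  integral: above the equilibrium both fields have a common cubic lower bound, so that passing from
  \<open>a - 1\<close> to \<open>a\<close> takes a time integrable in \<open>a\<close>.\<close>

lemma hitting_time_le:
  assumes "0 \<le> t" "b \<le> x t"
  shows "hitting_time x b \<le> ereal t"
  unfolding hitting_time_def using assms by (intro Inf_lower) auto

lemma hitting_time_nonneg: "0 \<le> hitting_time x b"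
  unfolding hitting_time_def by (intro Inf_greatest) auto

lemma hitting_time_mono: "b \<le> c \<Longrightarrow> hitting_time x b \<le> hitting_time x c"
  unfolding hitting_time_def by (intro Inf_superset_mono) auto

text \<open>By continuity the times at or above the level form a closed set, bounded below by 0, so
  the infimum belongs to it when the set is nonempty.\<close>

lemma hitting_time_attained:
  assumes cont: "continuous_on {0..} x" and fin: "hitting_time x b < \<infinity>"
  obtains t where "0 \<le> t" "hitting_time x b = ereal t" "b \<le> x t"
proof -
  define H where "H = {t. 0 \<le> t \<and> b \<le> x t}"
  have "H \<noteq> {}"
  proof
    assume "H = {}"
    then have "hitting_time x b = \<infinity>"
      unfolding hitting_time_def H_def[symmetric] by (simp add: top_ereal_def)
    with fin show False by simp
  qed
  moreover have "closed H"
  proof -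
    have "H = {0..} \<inter> x -` {b..}" by (auto simp: H_def)
    then show ?thesis
      using continuous_closed_preimage[OF cont closed_atLeast closed_atLeast] by simp
  qed
  moreover have "bdd_below H" by (rule bdd_belowI[of _ 0]) (auto simp: H_def)
  ultimately have "Inf H \<in> H" and "\<And>s. s \<in> H \<Longrightarrow> Inf H \<le> s"
    by (auto intro: closed_contains_Inf cInf_lower)
  then have "hitting_time x b = ereal (Inf H)"
    unfolding hitting_time_def H_def[symmetric] by (intro antisym Inf_lower Inf_greatest) auto
  then show thesis
    using \<open>Inf H \<in> H\<close> by (intro that[of "Inf H"]) (auto simp: H_def)
qed

lemma hitting_time_finite_iff:
  assumes "continuous_on {0..} x"
  shows "hitting_time x b < \<infinity> \<longleftrightarrow> (\<exists>t\<ge>0. b \<le> x t)"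
proof
  assume "hitting_time x b < \<infinity>"
  from hitting_time_attained[OF assms this] show "\<exists>t\<ge>0. b \<le> x t" by metis
next
  assume "\<exists>t\<ge>0. b \<le> x t"
  then obtain t where "0 \<le> t" "b \<le> x t" by blast
  then have "hitting_time x b \<le> ereal t" by (rule hitting_time_le)
  also have "\<dots> < \<infinity>" by simp
  finally show "hitting_time x b < \<infinity>" .
qed

lemma bernoulli_ode:
  fixes x :: "real \<Rightarrow> real"
  assumes st: "s \<le> t" and cont: "continuous_on {s..t} x"
    and ode: "\<And>v. v \<in> {s..t} \<Longrightarrow> ((\<lambda>u. p * x u + x u ^ 3) has_integral (x v - x s)) {s..v}"
    and pos: "0 < x s" and "p \<noteq> 0"
  shows "0 < x t"
    and "exp (2 * p * (t - s)) / (x t)\<^sup>2 = 1 / (x s)\<^sup>2 - (exp (2 * p * (t - s)) - 1) / p"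
proof -
  have f: "continuous_on {s..t} (\<lambda>u. p * x u + x u ^ 3)"
    and q: "continuous_on {s..t} (\<lambda>u. p + (x u)\<^sup>2)"
    using cont by (auto intro!: continuous_intros)
  have dx: "(x has_field_derivative p * x v + x v ^ 3) (at v within {s..t})" if v: "v \<in> {s..t}" for v
  proof -
    have "((\<lambda>v. x s + integral {s..v} (\<lambda>u. p * x u + x u ^ 3)) has_field_derivative p * x v + x v ^ 3)
        (at v within {s..t})"
      using integral_has_real_derivative[OF f v] by (auto intro!: derivative_eq_intros)
    then show ?thesis
      by (rule has_field_derivative_transform_within[OF _ zero_less_one v])
        (simp add: ode[THEN integral_unique])
  qed
  define Q where "Q v = integral {s..v} (\<lambda>u. p + (x u)\<^sup>2)" for v
  have dQ: "(Q has_field_derivative p + (x v)\<^sup>2) (at v within {s..t})" if v: "v \<in> {s..t}" for v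
    unfolding Q_def using integral_has_real_derivative[OF q v] .
  \<comment> \<open>Read as \<open>x' = (p + x\<^sup>2) * x\<close>, the equation makes
    \<open>x\<close> a multiple of \<open>exp Q\<close>, so \<open>x\<close> keeps its sign. This
    has to be settled before dividing by \<open>x\<^sup>2\<close>.\<close>
  have "\<exists>c. \<forall>v\<in>{s..t}. x v * exp (- Q v) = c"
  proof (rule has_field_derivative_zero_constant)
    fix v assume v: "v \<in> {s..t}"
    show "((\<lambda>v. x v * exp (- Q v)) has_field_derivative 0) (at v within {s..t})"
      by (auto intro!: derivative_eq_intros dx[OF v] dQ[OF v]
          simp: power2_eq_square power3_eq_cube algebra_simps)
  qed simp
  then obtain c where c: "\<And>v. v \<in> {s..t} \<Longrightarrow> x v * exp (- Q v) = c" by blast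
  have "0 < c" using c[of s] st pos by auto
  then have xpos: "0 < x v" if "v \<in> {s..t}" for v
    using c[OF that] by (metis exp_gt_zero zero_less_mult_pos2)
  show "0 < x t" using xpos st by simp
  \<comment> \<open>The variable y = 1 / \<open>x\<^sup>2\<close> solves y' = - 2 p y - 2, with
    equilibrium \<open>- 1 / p\<close>; hence y + 1 / p decays like
    \<open>exp (- 2 * p * v)\<close>.\<close>
  have "\<exists>c. \<forall>v\<in>{s..t}. exp (2 * p * (v - s)) / (x v)\<^sup>2 + exp (2 * p * (v - s)) / p = c"
  proof (rule has_field_derivative_zero_constant)
    fix v assume v: "v \<in> {s..t}"
    have "x v \<noteq> 0" using xpos[OF v] by simp
    then show "((\<lambda>v. exp (2 * p * (v - s)) / (x v)\<^sup>2 + exp (2 * p * (v - s)) / p)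
        has_field_derivative 0) (at v within {s..t})"
      using \<open>p \<noteq> 0\<close>
      by (auto intro!: derivative_eq_intros dx[OF v]
          simp: field_simps power2_eq_square power3_eq_cube)
  qed simp
  then obtain d where
    d: "\<And>v. v \<in> {s..t} \<Longrightarrow> exp (2 * p * (v - s)) / (x v)\<^sup>2 + exp (2 * p * (v - s)) / p = d"
    by blast
  show "exp (2 * p * (t - s)) / (x t)\<^sup>2 = 1 / (x s)\<^sup>2 - (exp (2 * p * (t - s)) - 1) / p"
    using d[of s] d[of t] st by (simp add: diff_divide_distrib)
qed

text \<open>The velocity jumps with the chain, so only its integrals are used. It is bounded below
  by \<open>k\<close> only while the path is above \<open>b\<close>; the gap between
  \<open>d\<close> and \<open>b\<close> gives continuity room to show that the path never falls
  below \<open>b\<close> again. It then covers \<open>c - b\<close> at speed at least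
  \<open>k\<close>.\<close>

lemma hitting_time_increment:
  fixes x v :: "real \<Rightarrow> real"
  assumes cont: "continuous_on {0..} x"
    and ode: "\<And>t. 0 \<le> t \<Longrightarrow> ereal t \<le> hitting_time x a \<Longrightarrow> (v has_integral x t - x 0) {0..t}"
    and lower: "\<And>u. b \<le> x u \<Longrightarrow> k \<le> v u"
    and lower_pos: "\<And>u. d < x u \<Longrightarrow> 0 \<le> v u"
    and k: "0 < k" and db: "d < b" and s: "0 \<le> s" "b \<le> x s" and bc: "b \<le> c" "c \<le> a"
  shows "hitting_time x c \<le> ereal (s + (c - b) / k)"
proof (rule ccontr)
  define e where "e = s + (c - b) / k"
  assume "\<not> hitting_time x c \<le> ereal (s + (c - b) / k)"
  then have neg: "ereal e < hitting_time x c" by (simp add: e_def)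
  have se: "s \<le> e" using bc k by (simp add: e_def)
  have incr: "(v has_integral x u - x t) {t..u}" if "0 \<le> t" "t \<le> u" "u \<le> e" for t u
  proof -
    have le: "ereal w \<le> hitting_time x a" if "w \<le> e" for w
    proof -
      have "ereal w \<le> ereal e" using that by simp
      also have "\<dots> \<le> hitting_time x c" using neg by simp
      also have "\<dots> \<le> hitting_time x a" by (rule hitting_time_mono[OF bc(2)])
      finally show ?thesis .
    qed
    have 1: "(v has_integral x t - x 0) {0..t}" and 2: "(v has_integral x u - x 0) {0..u}"
      using ode[OF _ le] that by auto
    have "v integrable_on {t..u}"
      using integrable_on_subinterval[OF has_integral_integrable[OF 2]] that by auto
    moreover have "integral {0..t} v + integral {t..u} v = integral {0..u} v"
      using that has_integral_integrable[OF 2] by (intro Henstock_Kurzweil_Integration.integral_combine) auto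
    ultimately show ?thesis
      using 1 2 by (simp add: has_integral_iff)
  qed
  have stay: "b \<le> x t" if t: "t \<in> {s..e}" for t
  proof (rule ccontr)
    assume neg_t: "\<not> b \<le> x t"
    \<comment> \<open>\<open>Sup S\<close> is the last time up to \<open>t\<close> at or above
      \<open>b\<close>. Just after it the path is still above \<open>d\<close>, where
      \<open>v\<close> is nonnegative, so it cannot have dropped below \<open>b\<close>.\<close>
    define S where "S = {u \<in> {s..t}. b \<le> x u}"
    have ct: "continuous_on {s..t} x"
      using cont by (rule continuous_on_subset) (use s in auto)
    have "S = {s..t} \<inter> x -` {b..}" by (auto simp: S_def)
    then have "closed S"
      using continuous_closed_preimage[OF ct closed_atLeastAtMost closed_atLeast] by simp
    moreover have "s \<in> S" using s t by (auto simp: S_def)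
    moreover have bdd: "bdd_above S" by (rule bdd_aboveI[of _ t]) (auto simp: S_def)
    ultimately have sup: "Sup S \<in> S" by (intro closed_contains_Sup) auto
    then have S: "s \<le> Sup S" "Sup S < t" "b \<le> x (Sup S)"
      using neg_t by (auto simp: S_def order_less_le)
    obtain h where h: "0 < h" "\<And>u. u \<in> {s..t} \<Longrightarrow> \<bar>u - Sup S\<bar> < h \<Longrightarrow> \<bar>x u - x (Sup S)\<bar> < b - d"
      using ct[unfolded continuous_on_iff dist_real_def, rule_format, of "Sup S" "b - d"] db S
      by auto
    define u where "u = min t (Sup S + h / 2)"
    have u: "Sup S < u" "u \<le> t" "u < Sup S + h" using S h(1) by (auto simp: u_def)
    have above: "0 \<le> v w" if "w \<in> {Sup S..u}" for w
      using h(2)[of w] that u S by (intro lower_pos) auto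
    have "(v has_integral x u - x (Sup S)) {Sup S..u}"
      using incr S s u t by simp
    then have "0 \<le> x u - x (Sup S)"
      by (rule has_integral_nonneg) (rule above)
    then have "u \<in> S" using S u by (auto simp: S_def)
    then show False using cSup_upper[OF _ bdd, of u] u by simp
  qed
  have "(v has_integral x e - x s) {s..e}" using incr s se by simp
  moreover have "((\<lambda>u. k) has_integral k * (e - s)) {s..e}"
    using has_integral_const_real[of k s e] se by (simp add: mult.commute)
  ultimately have "k * (e - s) \<le> x e - x s"
    using lower[OF stay] has_integral_le by blast
  then have "c \<le> x e" using s k by (simp add: e_def)
  then show False
    using hitting_time_le[of e c x] neg s se by auto
qed

section \<open>Paths driven by a switching sequence\<close>

text \<open>The weights \<open>1 / rate\<close> give the jump times and the weights
  \<open>slope\<close> give \<open>A\<close> at the jumps, so that one limit theorem serves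
  both.\<close>

definition walk :: "(int \<Rightarrow> real) \<Rightarrow> int \<Rightarrow> (nat \<Rightarrow> real) \<Rightarrow> nat \<Rightarrow> real" where
  "walk q i \<xi> n = (\<Sum>k<n. q ((-1) ^ k * i) * \<xi> k)"

lemma walk_0 [simp]: "walk q i \<xi> 0 = 0"
  by (simp add: walk_def)

lemma walk_Suc: "walk q i \<xi> (Suc n) = walk q i \<xi> n + q ((-1) ^ n * i) * \<xi> n"
  by (simp add: walk_def)

text \<open>Removing the first variable leaves the walk of a chain started in the other state; this
  is the recursion behind all conditioning on the first holding time.\<close>

lemma walk_case_nat: "walk q i (case_nat s \<xi>) (Suc n) = q i * s + walk q (- i) \<xi> n"
  unfolding walk_def by (subst sum.lessThan_Suc_shift) simp

lemma walk_uminus: "walk (\<lambda>j. - q j) i \<xi> = (\<lambda>n. - walk q i \<xi> n)"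
  by (simp add: fun_eq_iff walk_def sum_negf)

lemma jump_time_eq_walk: "jump_time lm lp = walk (\<lambda>j. 1 / rate lm lp j)"
  by (intro ext) (simp add: jump_time_def walk_def)

locale switching =
  fixes pm pp lm lp :: real
  assumes pm: "pm < 0" and pp: "0 < pp" and lm: "0 < lm" and lp: "0 < lp"
begin

definition drift :: "int \<Rightarrow> real" where
  "drift i = (if i = 1 then pp else pm)"

text \<open>A holding time is a standard exponential variable divided by the rate, so this is the
  change of \<open>A\<close> per unit of that variable.\<close>

definition slope :: "int \<Rightarrow> real" where
  "slope i = drift i / rate lm lp i"

text \<open>With \<open>A\<^sub>t\<close> the integral of the drift along the chain, \<open>walk slope\<close> is \<open>A\<close> at the jump times, and
  \<open>J\<close> is the integral of \<open>2 exp (2 A)\<close> up to the \<open>n\<close>-th jump.\<close>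

definition J :: "int \<Rightarrow> (nat \<Rightarrow> real) \<Rightarrow> nat \<Rightarrow> real" where
  "J i \<xi> n = (\<Sum>k<n. (exp (2 * walk slope i \<xi> (Suc k)) - exp (2 * walk slope i \<xi> k)) / drift ((-1) ^ k * i))"

lemma drift_nz [simp]: "drift i \<noteq> 0"
  using pm pp by (simp add: drift_def)

lemma rate_pos [simp]: "0 < rate lm lp i"
  using lm lp by (simp add: rate_def)

lemma J_0 [simp]: "J i \<xi> 0 = 0"
  by (simp add: J_def)

lemma J_Suc: "J i \<xi> (Suc n) = J i \<xi> n +
    (exp (2 * walk slope i \<xi> (Suc n)) - exp (2 * walk slope i \<xi> n)) / drift ((-1) ^ n * i)"
  by (simp add: J_def)

text \<open>The quotient is the integral of \<open>2 * exp (2 * A)\<close> over a stretch of length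
  \<open>h\<close> on which \<open>A\<close> has slope \<open>drift i\<close>.\<close>

lemma exp_diff_nonneg:
  "0 \<le> h \<Longrightarrow> 0 \<le> (exp (2 * (A + drift i * h)) - exp (2 * A)) / drift i"
  using pm pp by (auto simp: drift_def mult_nonneg_nonpos intro!: divide_nonneg_pos divide_nonpos_neg)

lemma J_step_nonneg:
  assumes "0 \<le> \<xi> n"
  shows "0 \<le> (exp (2 * walk slope i \<xi> (Suc n)) - exp (2 * walk slope i \<xi> n)) / drift ((-1) ^ n * i)"
  using exp_diff_nonneg[of "\<xi> n / rate lm lp ((-1) ^ n * i)" "walk slope i \<xi> n" "(-1) ^ n * i"] assms
  by (simp add: walk_Suc slope_def order_less_imp_le)

lemma J_mono: "(\<And>k. 0 \<le> \<xi> k) \<Longrightarrow> m \<le> n \<Longrightarrow> J i \<xi> m \<le> J i \<xi> n"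
  using lift_Suc_mono_le[of "J i \<xi>" m n] J_step_nonneg by (simp add: J_Suc)

text \<open>There is equality in state 1. In state -1 the numerator is at most 0, so dividing by
  \<open>pp\<close> gives a nonpositive number and dividing by \<open>pm\<close> a nonnegative one.
  With the common denominator \<open>pp\<close> the steps telescope.\<close>

lemma J_lower_step:
  assumes "0 \<le> h"
  shows "(exp (2 * (A + drift i * h)) - exp (2 * A)) / pp
    \<le> (exp (2 * (A + drift i * h)) - exp (2 * A)) / drift i"
proof (cases "i = 1")
  case False
  have "exp (2 * (A + pm * h)) - exp (2 * A) \<le> 0"
    using assms pm by (simp add: mult_nonneg_nonpos)
  then have "(exp (2 * (A + pm * h)) - exp (2 * A)) / pp \<le> 0"
    and "0 \<le> (exp (2 * (A + pm * h)) - exp (2 * A)) / pm"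
    using pm pp by (auto simp: divide_nonpos_pos divide_nonpos_neg)
  then show ?thesis using False by (simp add: drift_def)
qed (simp add: drift_def)

text \<open>The mirror image of \<open>J_lower_step\<close>: equality in state -1, opposite signs in
  state 1, and telescoping with the denominator \<open>pm\<close>.\<close>

lemma J_upper_step:
  assumes "0 \<le> h"
  shows "(exp (2 * (A + drift i * h)) - exp (2 * A)) / pm
    \<le> (exp (2 * (A + drift i * h)) - exp (2 * A)) / drift i"
proof (cases "i = 1")
  case True
  have "0 \<le> exp (2 * (A + pp * h)) - exp (2 * A)"
    using assms pp by simp
  then have "(exp (2 * (A + pp * h)) - exp (2 * A)) / pm \<le> 0"
    and "0 \<le> (exp (2 * (A + pp * h)) - exp (2 * A)) / pp"
    using pm pp by (auto simp: divide_nonneg_neg)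
  then show ?thesis using True by (simp add: drift_def)
qed (simp add: drift_def)

lemma walk_slope_Suc:
  "walk slope i \<xi> (Suc n) = walk slope i \<xi> n + drift ((-1) ^ n * i) * (\<xi> n / rate lm lp ((-1) ^ n * i))"
  by (simp add: walk_Suc slope_def)

text \<open>Telescoping of \<open>J_lower_step\<close>; it makes the integral unbounded as soon as
  \<open>A\<close> is unbounded above.\<close>

lemma J_ge:
  assumes "\<And>k. 0 \<le> \<xi> k"
  shows "(exp (2 * walk slope i \<xi> n) - 1) / pp \<le> J i \<xi> n"
proof (induction n)
  case (Suc n)
  show ?case
    using Suc J_lower_step[of "\<xi> n / rate lm lp ((-1) ^ n * i)" "walk slope i \<xi> n" "(-1) ^ n * i"] assms[of n]
    by (simp add: J_Suc walk_slope_Suc order_less_imp_le diff_divide_distrib)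
qed simp

text \<open>After the \<open>m\<close>-th jump the integral still grows by at least \<open>- exp (2 A) / pm\<close>, its growth if the chain
  stayed in \<open>-1\<close> for ever.\<close>

lemma J_minus_exp_mono:
  assumes "\<And>k. 0 \<le> \<xi> k" "m \<le> n"
  shows "J i \<xi> m - exp (2 * walk slope i \<xi> m) / pm \<le> J i \<xi> n - exp (2 * walk slope i \<xi> n) / pm"
  using assms(2)
proof (rule lift_Suc_mono_le[rotated])
  fix n show "J i \<xi> n - exp (2 * walk slope i \<xi> n) / pm \<le> J i \<xi> (Suc n) - exp (2 * walk slope i \<xi> (Suc n)) / pm"
    using J_upper_step[of "\<xi> n / rate lm lp ((-1) ^ n * i)" "walk slope i \<xi> n" "(-1) ^ n * i"] assms(1)[of n]
    by (simp add: J_Suc walk_slope_Suc order_less_imp_le diff_divide_distrib)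
qed

end

text \<open>Collects the almost sure properties of one outcome, so that the fate of its path becomes
  a deterministic question about \<open>\<xi>\<close> and \<open>x 0\<close>.\<close>

locale switched_path = switching +
  fixes i :: int and \<xi> :: "nat \<Rightarrow> real" and x :: "real \<Rightarrow> real" and E :: "real \<Rightarrow> int" and a :: real
  assumes i: "i \<in> {-1, 1}" and \<xi>: "\<And>k. 0 < \<xi> k"
    and jumps: "filterlim (jump_time lm lp i \<xi>) at_top sequentially"
    and cont: "continuous_on {0..} x" and x0: "0 < x 0"
    and chain: "\<And>t n. 0 \<le> t \<Longrightarrow> jump_time lm lp i \<xi> n \<le> t \<Longrightarrow> t < jump_time lm lp i \<xi> (Suc n)
      \<Longrightarrow> E t = (-1) ^ n * i"
    and ode: "\<And>t. 0 \<le> t \<Longrightarrow> ((\<lambda>s. vfield pm pp (E s) (x s)) has_integral (x t - x 0))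
      {0 .. real_of_ereal (min (ereal t) (hitting_time x a))}"
begin

abbreviation "T \<equiv> jump_time lm lp i \<xi>"
abbreviation "A \<equiv> walk slope i \<xi>"
abbreviation "K \<equiv> J i \<xi>"
abbreviation "st n \<equiv> (-1) ^ n * i"

lemma T_0: "T 0 = 0"
  by (simp add: jump_time_def)

lemma T_Suc: "T (Suc n) = T n + \<xi> n / rate lm lp (st n)"
  by (simp add: jump_time_def)

lemma T_less: "T n < T (Suc n)"
  using \<xi>[of n] by (simp add: T_Suc)

lemma T_nonneg: "0 \<le> T n"
proof (induction n)
  case (Suc n)
  then show ?case using T_less[of n] by linarith
qed (simp add: T_0)

lemma A_Suc: "A (Suc n) = A n + drift (st n) * (T (Suc n) - T n)"
  by (simp add: walk_slope_Suc T_Suc)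

lemma jump_interval:
  assumes "0 \<le> t"
  obtains n where "T n \<le> t" "t \<le> T (Suc n)"
proof -
  obtain m where m: "t < T m"
    using jumps unfolding filterlim_at_top_dense eventually_sequentially by blast
  define n where "n = (LEAST m. t < T m)"
  have n: "t < T n" unfolding n_def by (rule LeastI[of _ m]) (rule m)
  then obtain k where k: "n = Suc k" using assms T_0 by (cases n) auto
  have "\<not> t < T k" using not_less_Least[of k "\<lambda>m. t < T m"] k by (simp add: n_def)
  then show thesis using that[of k] n k by auto
qed

lemma jump_index_large:
  assumes "T m \<le> t" "t \<le> T (Suc n)" "T N < t"
  shows "N \<le> n"
proof (rule ccontr)
  assume "\<not> N \<le> n"
  then have "T (Suc n) \<le> T N"
    using lift_Suc_mono_le[of T "Suc n" N] T_less by (simp add: less_imp_le)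
  then show False using assms by simp
qed

lemma ode_before:
  assumes "0 \<le> t" "ereal t \<le> hitting_time x a"
  shows "((\<lambda>s. vfield pm pp (E s) (x s)) has_integral (x t - x 0)) {0..t}"
  using ode[OF assms(1)] assms(2) by (simp add: min_absorb1)

lemma ode_in_jump_interval:
  assumes s: "s = T n" and v: "s \<le> v" "v \<le> T (Suc n)" and hit: "ereal v \<le> hitting_time x a"
  shows "((\<lambda>u. drift (st n) * x u + x u ^ 3) has_integral (x v - x s)) {s..v}"
proof -
  let ?f = "\<lambda>u. vfield pm pp (E u) (x u)"
  have s0: "0 \<le> s" using T_nonneg s by simp
  have hs: "ereal s \<le> hitting_time x a" using hit v(1) by (meson ereal_less_eq(3) order_trans)
  have 1: "(?f has_integral x s - x 0) {0..s}" and 2: "(?f has_integral x v - x 0) {0..v}"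
    using ode_before hit hs s0 v by auto
  have "?f integrable_on {s..v}"
    using integrable_on_subinterval[OF has_integral_integrable[OF 2]] s0 by auto
  moreover have "integral {0..s} ?f + integral {s..v} ?f = integral {0..v} ?f"
    using s0 v has_integral_integrable[OF 2]
    by (intro Henstock_Kurzweil_Integration.integral_combine) auto
  ultimately have "(?f has_integral x v - x s) {s..v}"
    using 1 2 by (simp add: has_integral_iff)
  then show ?thesis
  \<comment> \<open>The state is known only on the half-open holding interval; its right end is
    discarded as a single exceptional point.\<close>
  proof (rule has_integral_spike_finite[of "{T (Suc n)}", rotated 2])
    fix u assume "u \<in> {s..v} - {T (Suc n)}"
    then have "E u = st n" using chain[of u n] s s0 v by auto
    then show "drift (st n) * x u + x u ^ 3 = ?f u"
      by (simp add: vfield_def drift_def)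
  qed simp
qed

text \<open>Multiplying the Bernoulli identity of the current holding interval by
  \<open>exp (2 * A n)\<close> extends the identity accumulated up to \<open>T n\<close>.\<close>

lemma solution_step:
  assumes pos: "0 < x (T n)" and v: "T n \<le> v" "v \<le> T (Suc n)" and hit: "ereal v \<le> hitting_time x a"
    and eq: "exp (2 * A n) / (x (T n))\<^sup>2 = 1 / (x 0)\<^sup>2 - K n"
  shows "0 < x v"
    and "exp (2 * (A n + drift (st n) * (v - T n))) / (x v)\<^sup>2 =
      1 / (x 0)\<^sup>2 - K n - (exp (2 * (A n + drift (st n) * (v - T n))) - exp (2 * A n)) / drift (st n)"
proof -
  let ?p = "drift (st n)" and ?s = "T n"
  have c: "continuous_on {?s..v} x"
    using cont by (rule continuous_on_subset) (use T_nonneg[of n] in auto)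
  have ode': "((\<lambda>u. ?p * x u + x u ^ 3) has_integral (x w - x ?s)) {?s..w}" if "w \<in> {?s..v}" for w
  proof (rule ode_in_jump_interval)
    have "ereal w \<le> ereal v" using that by simp
    then show "ereal w \<le> hitting_time x a" using hit by (rule order_trans)
  qed (use that v in auto)
  note b = bernoulli_ode[OF v(1) c ode' pos drift_nz]
  show "0 < x v" by (rule b(1))
  have e: "exp (2 * (A n + ?p * (v - ?s))) = exp (2 * A n) * exp (2 * ?p * (v - ?s))"
    by (simp add: exp_add[symmetric] algebra_simps)
  have "exp (2 * (A n + ?p * (v - ?s))) / (x v)\<^sup>2
      = exp (2 * A n) * (exp (2 * ?p * (v - ?s)) / (x v)\<^sup>2)"
    unfolding e by simp
  also have "exp (2 * ?p * (v - ?s)) / (x v)\<^sup>2 = 1 / (x ?s)\<^sup>2 - (exp (2 * ?p * (v - ?s)) - 1) / ?p"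
    by (rule b(2))
  also have "exp (2 * A n) * \<dots> = exp (2 * A n) / (x ?s)\<^sup>2
      - exp (2 * A n) * (exp (2 * ?p * (v - ?s)) - 1) / ?p"
    by (simp add: right_diff_distrib)
  also have "exp (2 * A n) * (exp (2 * ?p * (v - ?s)) - 1) = exp (2 * (A n + ?p * (v - ?s))) - exp (2 * A n)"
    unfolding e by (simp add: right_diff_distrib)
  finally show "exp (2 * (A n + ?p * (v - ?s))) / (x v)\<^sup>2 =
      1 / (x 0)\<^sup>2 - K n - (exp (2 * (A n + ?p * (v - ?s))) - exp (2 * A n)) / ?p"
    using eq by simp
qed

lemma solution_at_jump:
  assumes "ereal (T n) \<le> hitting_time x a"
  shows "0 < x (T n) \<and> exp (2 * A n) / (x (T n))\<^sup>2 = 1 / (x 0)\<^sup>2 - K n"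
  using assms
proof (induction n)
  case 0
  then show ?case using x0 by (simp add: T_0)
next
  case (Suc n)
  have "ereal (T n) \<le> hitting_time x a"
    using T_less[of n] Suc.prems by (meson ereal_less_eq(3) less_imp_le order_trans)
  then have IH: "0 < x (T n)" "exp (2 * A n) / (x (T n))\<^sup>2 = 1 / (x 0)\<^sup>2 - K n"
    using Suc.IH by auto
  show ?case
    using solution_step[OF IH(1) less_imp_le[OF T_less] order_refl Suc.prems IH(2)]
    unfolding A_Suc[symmetric] by (simp add: J_Suc)
qed

lemma solution:
  assumes "T n \<le> v" "v \<le> T (Suc n)" "ereal v \<le> hitting_time x a"
  shows "0 < x v"
    and "exp (2 * (A n + drift (st n) * (v - T n))) / (x v)\<^sup>2 =
      1 / (x 0)\<^sup>2 - K n - (exp (2 * (A n + drift (st n) * (v - T n))) - exp (2 * A n)) / drift (st n)"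
proof -
  have "ereal (T n) \<le> hitting_time x a"
    using assms by (meson ereal_less_eq(3) order_trans)
  from solution_at_jump[OF this] solution_step assms
  show "0 < x v"
    and "exp (2 * (A n + drift (st n) * (v - T n))) / (x v)\<^sup>2 =
      1 / (x 0)\<^sup>2 - K n - (exp (2 * (A n + drift (st n) * (v - T n))) - exp (2 * A n)) / drift (st n)"
    by auto
qed

text \<open>As long as the path is not stopped, the difference
  \<open>1 / (x 0)\<^sup>2 - K n\<close> equals a positive quantity. Contrapositively, an integral
  reaching \<open>1 / (x 0)\<^sup>2\<close> forces the path up to \<open>a\<close>.\<close>

lemma J_less_of_not_hitting:
  assumes "hitting_time x a = \<infinity>"
  shows "K n < 1 / (x 0)\<^sup>2"
proof -
  have "0 < x (T n)" and "exp (2 * A n) / (x (T n))\<^sup>2 = 1 / (x 0)\<^sup>2 - K n"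
    using solution_at_jump[of n] assms by auto
  moreover from this(1) have "0 < exp (2 * A n) / (x (T n))\<^sup>2" by simp
  ultimately show ?thesis by linarith
qed

text \<open>The identity keeps \<open>exp (2 * A) / (x t)\<^sup>2\<close> above the fixed gap
  \<open>d\<close>, so \<open>(x t)\<^sup>2\<close> is at most \<open>exp (2 * A) / d\<close>, which
  tends to 0.\<close>

lemma tendsto_0_of_not_hitting:
  assumes inf: "hitting_time x a = \<infinity>" and A: "filterlim A at_bot sequentially"
    and L: "\<And>n. K n \<le> L" "L < 1 / (x 0)\<^sup>2"
  shows "(x \<longlongrightarrow> 0) at_top"
proof (rule tendstoI)
  fix e :: real assume e: "0 < e"
  define d where "d = 1 / (x 0)\<^sup>2 - L"
  have d: "0 < d" using L by (simp add: d_def)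
  have "eventually (\<lambda>n. A n < ln (e\<^sup>2 * d) / 2) sequentially"
    using A unfolding filterlim_at_bot_dense by blast
  then obtain N where N: "\<And>n. N \<le> n \<Longrightarrow> A n < ln (e\<^sup>2 * d) / 2"
    unfolding eventually_sequentially by blast
  have "dist (x t) 0 < e" if t: "T N < t" for t
  proof -
    have "0 \<le> t" using T_nonneg[of N] t by simp
    then obtain n where n: "T n \<le> t" "t \<le> T (Suc n)" by (rule jump_interval)
    then have "N \<le> n" using jump_index_large t by blast
    let ?B = "A n + drift (st n) * (t - T n)"
    \<comment> \<open>\<open>A\<close> is linear between jumps, so its smallness at the jump times
      carries over to all times.\<close>
    have "?B \<le> max (A n) (A (Suc n))"
    proof (cases "0 \<le> drift (st n)")
      case True
      then have "?B \<le> A (Suc n)" unfolding A_Suc using n by (intro add_left_mono mult_left_mono) auto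
      then show ?thesis by simp
    next
      case False
      then have "?B \<le> A n" using n by (simp add: mult_nonpos_nonneg)
      then show ?thesis by simp
    qed
    also have "\<dots> < ln (e\<^sup>2 * d) / 2" using N[of n] N[of "Suc n"] \<open>N \<le> n\<close> by simp
    finally have "exp (2 * ?B) < exp (ln (e\<^sup>2 * d))" by simp
    then have B: "exp (2 * ?B) < e\<^sup>2 * d" using e d by simp
    have hit: "ereal t \<le> hitting_time x a" using inf by simp
    have pos: "0 < x t" using solution(1)[OF n hit] .
    have "K (Suc n) = K n + (exp (2 * A (Suc n)) - exp (2 * A n)) / drift (st n)" by (rule J_Suc)
    moreover have "(exp (2 * ?B) - exp (2 * A n)) / drift (st n)
        \<le> (exp (2 * A (Suc n)) - exp (2 * A n)) / drift (st n)"
      using exp_diff_nonneg[of "T (Suc n) - t" ?B "st n"] n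
      by (simp add: A_Suc diff_divide_distrib algebra_simps)
    ultimately have "d \<le> exp (2 * ?B) / (x t)\<^sup>2"
      unfolding solution(2)[OF n hit] using L(1)[of "Suc n"] by (simp add: d_def)
    then have "(x t)\<^sup>2 * d \<le> exp (2 * ?B)" using pos by (simp add: field_simps)
    then have "(x t)\<^sup>2 * d < e\<^sup>2 * d" using B by simp
    then have "x t < e" using d e by (simp add: power2_less_imp_less)
    then show ?thesis using pos by simp
  qed
  then show "eventually (\<lambda>t. dist (x t) 0 < e) at_top"
    unfolding eventually_at_top_dense by blast
qed

text \<open>At the hitting time \<open>x\<close> exceeds \<open>sqrt (- pm)\<close>, so the part of
  \<open>1 / (x 0)\<^sup>2\<close> not yet used up, \<open>exp (2 * ?B) / (x t)\<^sup>2\<close>, is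
  smaller than \<open>exp (2 * ?B) / (- pm)\<close>. The integral still to come is at least the
  latter.\<close>

lemma less_J_limit_of_hitting:
  assumes fin: "hitting_time x c < \<infinity>" and c: "sqrt (- pm) < c" "c \<le> a"
    and A: "filterlim A at_bot sequentially" and K: "K \<longlonglongrightarrow> L"
  shows "1 / (x 0)\<^sup>2 < L"
proof -
  obtain t where t: "0 \<le> t" "hitting_time x c = ereal t" "c \<le> x t"
    using hitting_time_attained[OF cont fin] .
  have hit: "ereal t \<le> hitting_time x a" using hitting_time_mono[OF c(2)] t(2) by metis
  obtain n where n: "T n \<le> t" "t \<le> T (Suc n)" using jump_interval[OF t(1)] .
  let ?B = "A n + drift (st n) * (t - T n)"
  have pos: "0 < x t" using solution(1)[OF n hit] .
  have "- pm < (x t)\<^sup>2"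
  proof -
    have "- pm = (sqrt (- pm))\<^sup>2" using pm by simp
    also have "\<dots> < (x t)\<^sup>2" using c t pm by (intro power_strict_mono) auto
    finally show ?thesis .
  qed
  then have "exp (2 * ?B) / (x t)\<^sup>2 < exp (2 * ?B) / (- pm)"
    using pm pos by (intro divide_strict_left_mono mult_pos_pos) auto
  then have "1 / (x 0)\<^sup>2 < K n + (exp (2 * ?B) - exp (2 * A n)) / drift (st n) - exp (2 * ?B) / pm"
    unfolding solution(2)[OF n hit] by simp
  also have "\<dots> \<le> K (Suc n) - exp (2 * A (Suc n)) / pm"
    using J_upper_step[of "T (Suc n) - t" ?B "st n"] n
    by (simp add: J_Suc A_Suc diff_divide_distrib algebra_simps)
  \<comment> \<open>The correction term vanishes in the limit because \<open>A\<close> tends to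
    minus infinity, so the nondecreasing sequence converges to \<open>L\<close>.\<close>
  also have "\<dots> \<le> L"
  proof (rule LIMSEQ_le_const)
    have "filterlim (\<lambda>n. 2 * A n) at_bot sequentially"
      using A by (simp add: filterlim_tendsto_pos_mult_at_bot[OF tendsto_const])
    then have "(\<lambda>n. exp (2 * A n)) \<longlonglongrightarrow> 0"
      using exp_at_bot by (rule filterlim_compose[rotated])
    then have "(\<lambda>n. K n - exp (2 * A n) / pm) \<longlonglongrightarrow> L - 0 / pm"
      using K pm by (intro tendsto_intros) auto
    then show "(\<lambda>n. K n - exp (2 * A n) / pm) \<longlonglongrightarrow> L" by simp
    show "\<exists>N. \<forall>m\<ge>N. K (Suc n) - exp (2 * A (Suc n)) / pm \<le> K m - exp (2 * A m) / pm"
      using J_minus_exp_mono[of \<xi> "Suc n"] \<xi> by (auto simp: less_imp_le)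
  qed
  finally show ?thesis .
qed

section \<open>Speed of the path above the equilibrium \<open>sqrt (- pm)\<close>\<close>

lemma vfield_ge:
  assumes "sqrt (- pm) \<le> b" "b \<le> y"
  shows "b * (b\<^sup>2 - (sqrt (- pm))\<^sup>2) \<le> vfield pm pp j y"
proof -
  have s: "0 \<le> sqrt (- pm)" using pm by simp
  then have by0: "0 \<le> b" "0 \<le> y" using assms by linarith+
  have "(sqrt (- pm))\<^sup>2 \<le> b\<^sup>2" using assms s by (intro power_mono) auto
  \<comment> \<open>The field of -1 factors as y (y^2 + pm), a product of factors that are
    nonnegative and increasing above the equilibrium; the field of 1 is larger there.\<close>
  then have "b * (b\<^sup>2 - (sqrt (- pm))\<^sup>2) \<le> y * (y\<^sup>2 - (sqrt (- pm))\<^sup>2)"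
    using assms by0 by (intro mult_mono diff_right_mono power_mono) linarith+
  also have "\<dots> = pm * y + y ^ 3"
    using pm by (simp add: algebra_simps power2_eq_square power3_eq_cube)
  also have "\<dots> \<le> vfield pm pp j y"
    using by0 pm pp mult_right_mono[of pm pp y] by (simp add: vfield_def)
  finally show ?thesis .
qed

lemma hitting_time_bound:
  assumes b: "sqrt (- pm) < b" "b \<le> c" "c \<le> a" and s: "0 \<le> s" "b \<le> x s"
  shows "hitting_time x c \<le> ereal (s + (c - b) / (b * (b\<^sup>2 - (sqrt (- pm))\<^sup>2)))"
proof (rule hitting_time_increment[OF cont])
  show "((\<lambda>s. vfield pm pp (E s) (x s)) has_integral (x t - x 0)) {0..t}"
    if "0 \<le> t" "ereal t \<le> hitting_time x a" for t
    using ode_before that .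
  show "b * (b\<^sup>2 - (sqrt (- pm))\<^sup>2) \<le> vfield pm pp (E u) (x u)" if "b \<le> x u" for u
    using vfield_ge[of b] that b by simp
  show "0 \<le> vfield pm pp (E u) (x u)" if "sqrt (- pm) < x u" for u
    using vfield_ge[of "sqrt (- pm)" "x u"] that by simp
  have r: "0 \<le> sqrt (- pm)" using pm by simp
  then have "(sqrt (- pm))\<^sup>2 < b\<^sup>2" using b by (intro power_strict_mono) auto
  then show "0 < b * (b\<^sup>2 - (sqrt (- pm))\<^sup>2)"
    using b r by (intro mult_pos_pos) linarith+
qed (use assms in auto)

lemma hitting_time_finite:
  assumes "sqrt (- pm) < b" "b \<le> c" "c \<le> a" and "hitting_time x b < \<infinity>"
  shows "hitting_time x c < \<infinity>"
proof -
  obtain t where "0 \<le> t" "b \<le> x t"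
    using assms(4) hitting_time_finite_iff[OF cont] by blast
  from hitting_time_bound[OF assms(1-3) this] show ?thesis
    by (rule order_le_less_trans) simp
qed

text \<open>With \<open>d = a - 1 - sqrt (- pm)\<close>, the speed above \<open>a - 1\<close> is at
  least \<open>k\<close>, and \<open>k\<close> dominates \<open>d\<^sup>2\<close>; so the passage
  takes at most \<open>1 / d\<^sup>2\<close>. The numerator 2 makes the bound strict. The difference
  of extended reals is a genuine one because the hitting time of \<open>a - 1\<close> is
  finite.\<close>

lemma hitting_time_diff_less:
  assumes "sqrt (- pm) + 2 \<le> a" and "hitting_time x (sqrt (- pm) + 1) < \<infinity>"
  shows "hitting_time x a - hitting_time x (a - 1) < ereal (2 / (a - 1 - sqrt (- pm))\<^sup>2)"
proof -
  let ?r = "sqrt (- pm)"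
  have r: "0 < ?r" using pm by simp
  have "hitting_time x (a - 1) < \<infinity>"
    by (rule hitting_time_finite[of "?r + 1"]) (use assms in auto)
  then obtain s where s: "0 \<le> s" "hitting_time x (a - 1) = ereal s" "a - 1 \<le> x s"
    using hitting_time_attained[OF cont] by blast
  define d where "d = a - 1 - ?r"
  define k where "k = (a - 1) * ((a - 1)\<^sup>2 - ?r\<^sup>2)"
  have d: "1 \<le> d" using assms by (simp add: d_def)
  have "d\<^sup>2 \<le> k"
  proof -
    have "k = ((a - 1) * (a - 1 + ?r)) * d"
      by (simp only: k_def d_def power2_eq_square) algebra
    moreover have "1 * d \<le> (a - 1) * (a - 1 + ?r)"
      using assms(1) r unfolding d_def by (intro mult_mono) linarith+
    ultimately show ?thesis
      using d by (simp add: power2_eq_square)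
  qed
  have "hitting_time x a \<le> ereal (s + (a - (a - 1)) / k)"
    unfolding k_def using assms s by (intro hitting_time_bound) auto
  also have "\<dots> < ereal (s + 2 / d\<^sup>2)"
  proof -
    have "0 < d\<^sup>2" using d by simp
    then have "1 / k \<le> 1 / d\<^sup>2" using \<open>d\<^sup>2 \<le> k\<close> by (simp add: frac_le)
    also have "\<dots> < 2 / d\<^sup>2" using d by (intro divide_strict_right_mono) auto
    finally show ?thesis by simp
  qed
  finally have "hitting_time x a < ereal (s + 2 / d\<^sup>2)" .
  then show ?thesis
    unfolding s(2) d_def[symmetric] by (cases "hitting_time x a") auto
qed

end

section \<open>Measurability of hitting times and limits\<close>

lemma sets_Collect_bex:
  assumes "countable D" and "\<And>q. q \<in> D \<Longrightarrow> {\<omega> \<in> space M. P q \<omega>} \<in> sets M"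
  shows "{\<omega> \<in> space M. \<exists>q\<in>D. P q \<omega>} \<in> sets M"
proof -
  have "{\<omega> \<in> space M. \<exists>q\<in>D. P q \<omega>} = (\<Union>q\<in>D. {\<omega> \<in> space M. P q \<omega>})" by auto
  then show ?thesis using assms by (simp add: sets.countable_UN'')
qed

lemma sets_Collect_ball:
  assumes "countable D" and "\<And>q. q \<in> D \<Longrightarrow> {\<omega> \<in> space M. P q \<omega>} \<in> sets M"
  shows "{\<omega> \<in> space M. \<forall>q\<in>D. P q \<omega>} \<in> sets M"
  using sets.sets_Collect_neg[OF sets_Collect_bex[of D M "\<lambda>q \<omega>. \<not> P q \<omega>"]] assms
  by (simp add: sets.sets_Collect_neg)

text \<open>Turns an uncountable infimum into countable operations. The level is relaxed to
  \<open>b - 1 / real (Suc n)\<close> because a path may touch \<open>b\<close> only at a time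
  outside \<open>D\<close>; conversely, the maximum over the compact interval recovers
  \<open>b\<close> itself.\<close>

lemma hitting_time_le_iff_dense:
  assumes cont: "continuous_on {0..} x" and t: "0 \<le> t"
    and D: "D \<subseteq> {0..t}" "{0..t} \<subseteq> closure D"
  shows "hitting_time x b \<le> ereal t \<longleftrightarrow> (\<forall>n::nat. \<exists>q\<in>D. b - 1 / real (Suc n) < x q)"
proof
  have ct: "continuous_on {0..t} x" using cont by (rule continuous_on_subset) auto
  have cl: "closure D = {0..t}" using D closure_minimal[OF D(1)] by auto
  assume le: "hitting_time x b \<le> ereal t"
  then have "hitting_time x b < \<infinity>" by (rule order_le_less_trans) simp
  then obtain s where s: "0 \<le> s" "hitting_time x b = ereal s" "b \<le> x s"
    using hitting_time_attained[OF cont] by blast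
  show "\<forall>n::nat. \<exists>q\<in>D. b - 1 / real (Suc n) < x q"
  proof (rule allI, rule ccontr)
    fix n :: nat assume "\<not> (\<exists>q\<in>D. b - 1 / real (Suc n) < x q)"
    then have "x s \<le> b - 1 / real (Suc n)"
      using continuous_le_on_closure[of D x s "b - 1 / real (Suc n)"] ct cl s le by (auto simp: not_less)
    moreover have "0 < 1 / real (Suc n)" by simp
    ultimately show False using s(3) by linarith
  qed
next
  assume *: "\<forall>n::nat. \<exists>q\<in>D. b - 1 / real (Suc n) < x q"
  have ct: "continuous_on {0..t} x" using cont by (rule continuous_on_subset) auto
  obtain m where m: "m \<in> {0..t}" "\<And>s. s \<in> {0..t} \<Longrightarrow> x s \<le> x m"
    using continuous_attains_sup[OF compact_Icc _ ct] t by auto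
  have "b - 1 / real (Suc n) \<le> x m" for n
    using * m(2) D(1) by (meson less_imp_le order_trans subsetD)
  moreover have "(\<lambda>n. b - 1 / real (Suc n)) \<longlonglongrightarrow> b - 0"
    by (intro tendsto_intros LIMSEQ_Suc[OF lim_1_over_n])
  ultimately have "b \<le> x m"
    by (intro LIMSEQ_le_const2[of _ b]) auto
  then have "hitting_time x b \<le> ereal m" using m by (intro hitting_time_le) auto
  also have "\<dots> \<le> ereal t" using m by simp
  finally show "hitting_time x b \<le> ereal t" .
qed

lemma borel_measurable_hitting_time:
  assumes X: "\<And>t. 0 \<le> t \<Longrightarrow> X t \<in> borel_measurable M"
    and cont: "\<And>\<omega>. \<omega> \<in> space M \<Longrightarrow> continuous_on {0..} (\<lambda>t. X t \<omega>)"
  shows "(\<lambda>\<omega>. hitting_time (\<lambda>t. X t \<omega>) b) \<in> borel_measurable M"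
proof (rule borel_measurableI_le)
  fix y :: ereal
  have neg: "{\<omega> \<in> space M. hitting_time (\<lambda>t. X t \<omega>) b \<le> y} \<in> sets M" if "y < 0"
  proof -
    have "{\<omega> \<in> space M. hitting_time (\<lambda>t. X t \<omega>) b \<le> y} = {}"
      using hitting_time_nonneg that by (auto simp: not_le intro: order_less_le_trans)
    then show ?thesis by (simp only: sets.empty_sets)
  qed
  show "{\<omega> \<in> space M. hitting_time (\<lambda>t. X t \<omega>) b \<le> y} \<in> sets M"
  proof (cases "y < 0")
    case False
    show ?thesis
    proof (cases y)
      case (real t)
      then have t: "0 \<le> t" using False by simp
      obtain D where D: "countable D" "D \<subseteq> {0..t}" "{0..t} \<subseteq> closure D"
        using separable[of "{0..t}"] .
      have "{\<omega> \<in> space M. hitting_time (\<lambda>t. X t \<omega>) b \<le> y} =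
          {\<omega> \<in> space M. \<forall>n::nat. \<exists>q\<in>D. b - 1 / real (Suc n) < X q \<omega>}"
        using hitting_time_le_iff_dense[OF cont t D(2,3)] unfolding real by blast
      also have "\<dots> \<in> sets M"
      proof (intro sets.sets_Collect_countable_All sets_Collect_bex[OF D(1)])
        fix n q assume "q \<in> D"
        then have [measurable]: "X q \<in> borel_measurable M"
          using D(2) by (intro X) auto
        show "{\<omega> \<in> space M. b - 1 / real (Suc n) < X q \<omega>} \<in> sets M" by measurable
      qed
      finally show ?thesis .
    qed (use False in auto)
  qed (rule neg)
qed

text \<open>The non-strict bound is a closed condition, so by continuity it passes from
  \<open>D N\<close> to its closure \<open>{real N..}\<close>.\<close>

lemma tendsto_0_iff_dense:
  fixes x :: "real \<Rightarrow> real"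
  assumes cont: "continuous_on {0..} x"
    and D: "\<And>N::nat. D N \<subseteq> {real N..}" "\<And>N::nat. {real N..} \<subseteq> closure (D N)"
  shows "(x \<longlongrightarrow> 0) at_top \<longleftrightarrow> (\<forall>k::nat. \<exists>N. \<forall>q\<in>D N. \<bar>x q\<bar> \<le> 1 / real (Suc k))"
proof
  assume lim: "(x \<longlongrightarrow> 0) at_top"
  show "\<forall>k::nat. \<exists>N. \<forall>q\<in>D N. \<bar>x q\<bar> \<le> 1 / real (Suc k)"
  proof
    fix k :: nat
    have "eventually (\<lambda>t. dist (x t) 0 < 1 / real (Suc k)) at_top"
      using tendstoD[OF lim] by simp
    then obtain t0 where t0: "\<And>t. t0 \<le> t \<Longrightarrow> dist (x t) 0 < 1 / real (Suc k)"
      unfolding eventually_at_top_linorder by blast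
    obtain N :: nat where "t0 \<le> real N" using real_arch_simple by blast
    then have "\<bar>x q\<bar> \<le> 1 / real (Suc k)" if "q \<in> D N" for q
      using t0[of q] D(1)[of N] that by force
    then show "\<exists>N. \<forall>q\<in>D N. \<bar>x q\<bar> \<le> 1 / real (Suc k)" by blast
  qed
next
  assume *: "\<forall>k::nat. \<exists>N. \<forall>q\<in>D N. \<bar>x q\<bar> \<le> 1 / real (Suc k)"
  show "(x \<longlongrightarrow> 0) at_top"
  proof (rule tendstoI)
    fix e :: real assume "0 < e"
    then obtain k where k: "1 / real (Suc k) < e" using nat_approx_posE by blast
    obtain N where N: "\<forall>q\<in>D N. \<bar>x q\<bar> \<le> 1 / real (Suc k)" using * by blast
    have cl: "closure (D N) = {real N..}" using D(2) closure_minimal[OF D(1)] by auto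
    have "continuous_on {real N..} (\<lambda>t. \<bar>x t\<bar>)"
      by (intro continuous_intros continuous_on_subset[OF cont]) auto
    then have "\<bar>x t\<bar> \<le> 1 / real (Suc k)" if "real N \<le> t" for t
      using continuous_le_on_closure[of "D N" "\<lambda>t. \<bar>x t\<bar>" t "1 / real (Suc k)"] N cl that by auto
    then have "dist (x t) 0 < e" if "real N \<le> t" for t
      using k that by (simp add: dist_real_def order_le_less_trans[OF _ k])
    then show "eventually (\<lambda>t. dist (x t) 0 < e) at_top"
      unfolding eventually_at_top_linorder by blast
  qed
qed

lemma sets_tendsto_0:
  fixes X :: "real \<Rightarrow> 'a \<Rightarrow> real"
  assumes X: "\<And>t. 0 \<le> t \<Longrightarrow> X t \<in> borel_measurable M"
    and cont: "\<And>\<omega>. \<omega> \<in> space M \<Longrightarrow> continuous_on {0..} (\<lambda>t. X t \<omega>)"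
  shows "{\<omega> \<in> space M. ((\<lambda>t. X t \<omega>) \<longlongrightarrow> 0) at_top} \<in> sets M"
proof -
  have "\<exists>D. countable D \<and> D \<subseteq> {real N..} \<and> {real N..} \<subseteq> closure D" for N :: nat
    using separable[of "{real N..}"] by metis
  then obtain D where D: "\<And>N. countable (D N)" "\<And>N::nat. D N \<subseteq> {real N..}"
    "\<And>N. {real N..} \<subseteq> closure (D N)" by metis
  have "{\<omega> \<in> space M. ((\<lambda>t. X t \<omega>) \<longlongrightarrow> 0) at_top} =
      {\<omega> \<in> space M. \<forall>k::nat. \<exists>N. \<forall>q\<in>D N. \<bar>X q \<omega>\<bar> \<le> 1 / real (Suc k)}"
    using tendsto_0_iff_dense[OF cont D(2,3)] by blast
  also have "\<dots> \<in> sets M"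
  proof (intro sets.sets_Collect_countable_All sets.sets_Collect_countable_Ex
      sets_Collect_ball[OF D(1)])
    fix k N q assume "q \<in> D N"
    then have [measurable]: "X q \<in> borel_measurable M"
      using D(2)[of N] of_nat_0_le_iff[of N] by (intro X) force
    show "{\<omega> \<in> space M. \<bar>X q \<omega>\<bar> \<le> 1 / real (Suc k)} \<in> sets M"
      by measurable
  qed
  finally show ?thesis .
qed

section \<open>Alternating walks with exponential steps\<close>

definition expo :: "real measure" where
  "expo = density lborel (\<lambda>x. ennreal (exponential_density 1 x))"

interpretation expo: prob_space expo
  unfolding expo_def by (rule prob_space_exponential_density) simp

interpretation expos: sequence_space expo ..

abbreviation "expos \<equiv> PiM (UNIV :: nat set) (\<lambda>_. expo)"

interpretation expo_pair: pair_sigma_finite expo expos ..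

lemma sets_expo [measurable_cong, simp]: "sets expo = sets borel"
  by (simp add: expo_def)

lemma space_expo [simp]: "space expo = UNIV"
  by (simp add: expo_def)

lemma space_expos [simp]: "space expos = UNIV"
  by (simp add: space_PiM)

lemma AE_expo_iff: "(AE s in expo. P s) \<longleftrightarrow> (AE s in lborel. 0 \<le> s \<longrightarrow> P s)"
  unfolding expo_def by (subst AE_density) (auto simp: exponential_density_def intro!: arg_cong2[where f = "almost_everywhere"])

lemma AE_expo_pos: "AE s in expo. 0 < s"
  unfolding AE_expo_iff using AE_lborel_singleton[of 0] by eventually_elim auto

lemma AE_expo_neq: "AE s in expo. s \<noteq> c"
  unfolding AE_expo_iff using AE_lborel_singleton[of c] by eventually_elim auto

text \<open>The density is positive on the half-line, so no interval there is null. This supplies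
  first holding times that are as long or as short as wanted and still typical.\<close>

lemma AE_expo_obtain:
  assumes "AE s in expo. P s" and uv: "0 \<le> u" "u < v"
  obtains s where "u < s" "s < v" "P s"
proof (rule ccontr)
  assume no: "\<not> thesis"
  have *: "\<not> P s" if "u < s" "s < v" for s using no that(1,2) \<open>\<And>s. u < s \<Longrightarrow> s < v \<Longrightarrow> P s \<Longrightarrow> thesis\<close> by blast
  have "AE s in lborel. s \<notin> {u<..<v}"
    using assms(1) unfolding AE_expo_iff by eventually_elim (use * uv in auto)
  then have "emeasure lborel {u<..<v} = 0"
    by (subst (asm) AE_iff_measurable[where N = "{u<..<v}"]) auto
  then show False using uv by simp
qed

text \<open>Tilting by \<open>exp (c * s)\<close> turns the density into that of parameter
  \<open>1 - c\<close>, up to the factor \<open>1 / (1 - c)\<close>.\<close>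

lemma nn_integral_exp_expo:
  assumes "c < 1"
  shows "(\<integral>\<^sup>+s. ennreal (exp (c * s)) \<partial>expo) = ennreal (1 / (1 - c))"
proof -
  have "(\<integral>\<^sup>+s. ennreal (exp (c * s)) \<partial>expo) =
      (\<integral>\<^sup>+s. ennreal (exponential_density 1 s) * ennreal (exp (c * s)) \<partial>lborel)"
    unfolding expo_def by (intro nn_integral_density) auto
  also have "\<dots> = (\<integral>\<^sup>+s. ennreal (1 / (1 - c)) * ennreal (exponential_density (1 - c) s) \<partial>lborel)"
    using assms
    by (intro nn_integral_cong)
      (simp add: exponential_density_def ennreal_mult'[symmetric] exp_add[symmetric] right_diff_distrib mult.commute)
  also have "\<dots> = ennreal (1 / (1 - c)) * (\<integral>\<^sup>+s. ennreal (exponential_density (1 - c) s) \<partial>lborel)"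
    by (intro nn_integral_cmult) auto
  also have "(\<integral>\<^sup>+s. ennreal (exponential_density (1 - c) s) \<partial>lborel) = 1"
    using prob_space.emeasure_space_1[OF prob_space_exponential_density[of "1 - c"]] assms
    by (simp add: emeasure_density)
  finally show ?thesis by simp
qed

lemma case_nat_measurable:
  "(\<lambda>(s, \<omega>). case_nat s \<omega>) \<in> measurable (expo \<Otimes>\<^sub>M expos) expos"
  by measurable

lemma AE_expos_shift:
  assumes "AE \<xi> in expos. P \<xi>"
  shows "AE s in expo. AE \<omega> in expos. P (case_nat s \<omega>)"
proof -
  have "AE \<xi> in distr (expo \<Otimes>\<^sub>M expos) expos (\<lambda>(s, \<omega>). case_nat s \<omega>). P \<xi>"
    using assms by (simp only: expos.PiM_iter)
  then have "AE z in expo \<Otimes>\<^sub>M expos. P ((\<lambda>(s, \<omega>). case_nat s \<omega>) z)"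
    by (rule AE_distrD[OF case_nat_measurable])
  from expo_pair.AE_pair[OF this] show ?thesis by simp
qed

text \<open>The order of the quantifiers is exchanged by Fubini: the tail is frozen first and only
  the first variable varies. This is the form needed to exploit that a single exponential variable
  has no atoms.\<close>

lemma AE_expos_shiftI:
  assumes P: "{\<xi> \<in> space expos. P \<xi>} \<in> sets expos"
    and ae: "AE \<omega> in expos. AE s in expo. P (case_nat s \<omega>)"
  shows "AE \<xi> in expos. P \<xi>"
proof -
  have S: "{z \<in> space (expo \<Otimes>\<^sub>M expos). P (case_nat (fst z) (snd z))} \<in> sets (expo \<Otimes>\<^sub>M expos)"
    using measurable_sets[OF case_nat_measurable P]
    by (simp add: vimage_def space_pair_measure case_prod_beta Int_def conj_commute)
  have "AE s in expo. AE \<omega> in expos. P (case_nat s \<omega>)"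
    using expo_pair.AE_commute[of "\<lambda>s \<omega>. P (case_nat s \<omega>)"] S ae by simp
  then have "AE z in expo \<Otimes>\<^sub>M expos. P (case_nat (fst z) (snd z))"
    using S by (intro expo_pair.AE_pair_measure) auto
  then have "AE \<xi> in distr (expo \<Otimes>\<^sub>M expos) expos (\<lambda>(s, \<omega>). case_nat s \<omega>). P \<xi>"
    using P case_nat_measurable by (subst AE_distr_iff) (auto simp: case_prod_beta)
  then show ?thesis by (simp only: expos.PiM_iter)
qed

lemma AE_expos_pos: "AE \<xi> in expos. \<forall>k. 0 < \<xi> k"
  unfolding AE_all_countable
  by (intro allI AE_PiM_component expo.prob_space_axioms AE_expo_pos) auto

lemma borel_measurable_walk [measurable]: "(\<lambda>\<xi>. walk q i \<xi> n) \<in> borel_measurable expos"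
  unfolding walk_def by measurable

lemma nn_integral_exp_walk_Suc:
  assumes "\<theta> * q i < 1"
  shows "(\<integral>\<^sup>+\<xi>. ennreal (exp (\<theta> * walk q i \<xi> (Suc n))) \<partial>expos) =
    ennreal (1 / (1 - \<theta> * q i)) * (\<integral>\<^sup>+\<xi>. ennreal (exp (\<theta> * walk q (- i) \<xi> n)) \<partial>expos)"
proof -
  have "(\<integral>\<^sup>+\<xi>. ennreal (exp (\<theta> * walk q i \<xi> (Suc n))) \<partial>expos) =
      (\<integral>\<^sup>+\<xi>. ennreal (exp (\<theta> * walk q i \<xi> (Suc n))) \<partial>distr (expo \<Otimes>\<^sub>M expos) expos (\<lambda>(s, \<omega>). case_nat s \<omega>))"
    by (simp only: expos.PiM_iter)
  also have "\<dots> = (\<integral>\<^sup>+z. ennreal (exp (\<theta> * walk q i (case_nat (fst z) (snd z)) (Suc n))) \<partial>(expo \<Otimes>\<^sub>M expos))"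
    using case_nat_measurable by (subst nn_integral_distr) (auto simp: case_prod_beta)
  also have "\<dots> = (\<integral>\<^sup>+z. ennreal (exp (\<theta> * q i * fst z)) * ennreal (exp (\<theta> * walk q (- i) (snd z) n)) \<partial>(expo \<Otimes>\<^sub>M expos))"
    by (intro nn_integral_cong)
      (simp add: walk_case_nat ennreal_mult'[symmetric] exp_add[symmetric] algebra_simps)
  also have "\<dots> = (\<integral>\<^sup>+s. \<integral>\<^sup>+\<omega>. ennreal (exp (\<theta> * q i * s)) * ennreal (exp (\<theta> * walk q (- i) \<omega> n)) \<partial>expos \<partial>expo)"
    by (subst expos.P.nn_integral_fst[symmetric]) auto
  also have "\<dots> = (\<integral>\<^sup>+s. ennreal (exp (\<theta> * q i * s)) \<partial>expo) * (\<integral>\<^sup>+\<omega>. ennreal (exp (\<theta> * walk q (- i) \<omega> n)) \<partial>expos)"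
    by (simp add: nn_integral_cmult nn_integral_multc)
  finally show ?thesis using nn_integral_exp_expo[OF assms] by simp
qed

text \<open>The product expands to 1 - \<theta> (c + d) + \<theta>^2 c d, where the positive linear
  term dominates for small \<theta>. The constant \<open>m\<close> bounds \<open>c\<close>,
  \<open>d\<close> and \<open>- (c * d)\<close>, and \<open>\<theta> * m = \<sigma> / 2\<close>
  makes each of them harmless.\<close>

lemma exp_moment_contraction:
  fixes c d :: real
  assumes "c + d < 0"
  obtains \<theta> where "0 < \<theta>" "\<theta> \<le> 1" "\<theta> * c < 1" "\<theta> * d < 1" "1 < (1 - \<theta> * c) * (1 - \<theta> * d)"
proof
  define m where "m = 1 + \<bar>c\<bar> + \<bar>d\<bar> + \<bar>c * d\<bar>"
  define \<sigma> where "\<sigma> = min 1 (- (c + d))"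
  define \<theta> where "\<theta> = \<sigma> / (2 * m)"
  have m: "1 \<le> m" "c \<le> m" "d \<le> m" "- (c * d) \<le> m" by (auto simp: m_def)
  have \<sigma>: "0 < \<sigma>" "\<sigma> \<le> 1" "\<sigma> \<le> - (c + d)" using assms by (auto simp: \<sigma>_def)
  have \<theta>m: "\<theta> * m = \<sigma> / 2" using m by (simp add: \<theta>_def)
  show \<theta>: "0 < \<theta>" using m \<sigma> by (simp add: \<theta>_def)
  have le: "\<theta> * y \<le> \<sigma> / 2" if "y \<le> m" for y
    using mult_left_mono[OF that, of \<theta>] \<theta> \<theta>m by simp
  show "\<theta> \<le> 1" using le[OF m(1)] \<sigma> by simp
  show "\<theta> * c < 1" "\<theta> * d < 1" using le[OF m(2)] le[OF m(3)] \<sigma> by auto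
  have "0 < - (c + d) - \<theta> * (- (c * d))" using le[OF m(4)] \<sigma> by linarith
  then have "0 < \<theta> * (- (c + d) - \<theta> * (- (c * d)))" using \<theta> by (rule mult_pos_pos[rotated])
  then show "1 < (1 - \<theta> * c) * (1 - \<theta> * d)" by (simp add: algebra_simps)
qed

text \<open>A small exponential moment of the walk decays geometrically, because over two steps it
  is multiplied by a factor below 1; hence the sum has finite expectation. This takes the place of a
  law of large numbers and also yields the convergence of the integral.\<close>

lemma AE_summable_exp_walk:
  assumes neg: "q 1 + q (-1) < 0"
  obtains \<theta> where "0 < \<theta>" "\<theta> \<le> 1"
    "\<And>i. i \<in> {-1, 1} \<Longrightarrow> AE \<xi> in expos. summable (\<lambda>n. exp (\<theta> * walk q i \<xi> n))"
proof -
  obtain \<theta> where \<theta>: "0 < \<theta>" "\<theta> \<le> 1" "\<theta> * q 1 < 1" "\<theta> * q (-1) < 1"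
    "1 < (1 - \<theta> * q 1) * (1 - \<theta> * q (-1))"
    using exp_moment_contraction[OF neg] .
  \<comment> \<open>\<open>m j\<close> is the exponential moment of a step from \<open>j\<close>; \<open>w\<close> is an eigenvector of the two-state transfer
    matrix with off-diagonal entries \<open>m 1, m (-1)\<close> and \<open>\<kappa>\<close> is its eigenvalue.\<close>
  define m where "m j = 1 / (1 - \<theta> * q j)" for j
  define \<kappa> where "\<kappa> = sqrt (m 1 * m (-1))"
  define w where "w j = sqrt (m j)" for j
  \<comment> \<open>Normalised so that \<open>C * w i\<close> is at least 1, the moment of the walk
    after zero steps.\<close>
  define C where "C = 1 / min (w 1) (w (-1))"
  have m: "0 < m 1" "0 < m (-1)" using \<theta> by (auto simp: m_def)
  have w: "0 < w 1" "0 < w (-1)" using m by (auto simp: w_def)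
  have C: "0 < C" "1 \<le> C * w 1" "1 \<le> C * w (-1)" using w by (auto simp: C_def)
  have "m 1 * m (-1) < 1" using \<theta> by (simp add: m_def)
  then have \<kappa>: "0 < \<kappa>" "\<kappa> < 1" using m by (auto simp: \<kappa>_def)
  have mw: "m i * w (- i) = \<kappa> * w i" if "i \<in> {-1, 1}" for i
    using that m by (auto simp: w_def \<kappa>_def real_sqrt_mult mult_ac)
  have bound: "(\<integral>\<^sup>+\<xi>. ennreal (exp (\<theta> * walk q i \<xi> n)) \<partial>expos) \<le> ennreal (C * w i * \<kappa> ^ n)"
    if "i \<in> {-1, 1}" for i n
    using that
  proof (induction n arbitrary: i)
    case 0
    then show ?case using C expos.emeasure_space_1 by auto
  next
    case (Suc n)
    have mi: "\<theta> * q i < 1" "0 < m i" using Suc.prems \<theta> m by auto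
    have "(\<integral>\<^sup>+\<xi>. ennreal (exp (\<theta> * walk q i \<xi> (Suc n))) \<partial>expos) =
        ennreal (m i) * (\<integral>\<^sup>+\<xi>. ennreal (exp (\<theta> * walk q (- i) \<xi> n)) \<partial>expos)"
      unfolding m_def using mi(1) by (rule nn_integral_exp_walk_Suc)
    also have "\<dots> \<le> ennreal (m i) * ennreal (C * w (- i) * \<kappa> ^ n)"
      using Suc.prems by (intro mult_left_mono Suc.IH) auto
    also have "\<dots> = ennreal (C * (m i * w (- i)) * \<kappa> ^ n)"
      using mi by (simp add: ennreal_mult'[symmetric] mult_ac)
    also have "\<dots> = ennreal (C * w i * \<kappa> ^ Suc n)"
      unfolding mw[OF Suc.prems] by (simp add: mult_ac)
    finally show ?case .
  qed
  have "AE \<xi> in expos. summable (\<lambda>n. exp (\<theta> * walk q i \<xi> n))" if i: "i \<in> {-1, 1}" for i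
  proof -
    have wi: "0 < w i" using i w by auto
    have "(\<integral>\<^sup>+\<xi>. (\<Sum>n. ennreal (exp (\<theta> * walk q i \<xi> n))) \<partial>expos) =
        (\<Sum>n. \<integral>\<^sup>+\<xi>. ennreal (exp (\<theta> * walk q i \<xi> n)) \<partial>expos)"
      by (intro nn_integral_suminf) auto
    also have "\<dots> \<le> (\<Sum>n. ennreal (C * w i * \<kappa> ^ n))"
      by (intro suminf_le bound i) auto
    also have "\<dots> = ennreal (\<Sum>n. C * w i * \<kappa> ^ n)"
      using C wi \<kappa> by (intro suminf_ennreal2) (auto intro!: summable_mult summable_geometric)
    also have "\<dots> < \<infinity>" by simp
    finally have "AE \<xi> in expos. (\<Sum>n. ennreal (exp (\<theta> * walk q i \<xi> n))) \<noteq> \<infinity>"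
      by (intro nn_integral_PInf_AE) auto
    then show ?thesis
      by eventually_elim (auto intro: summable_suminf_not_top)
  qed
  then show thesis using that \<theta> by blast
qed

lemma filterlim_at_bot_of_summable_exp:
  assumes "0 < \<theta>" and "summable (\<lambda>n. exp (\<theta> * f n :: real))"
  shows "filterlim f at_bot sequentially"
proof -
  have lim: "(\<lambda>n. exp (\<theta> * f n)) \<longlonglongrightarrow> 0" using assms(2) by (rule summable_LIMSEQ_zero)
  show ?thesis
    unfolding filterlim_at_bot
  proof
    fix Z :: real
    have "eventually (\<lambda>n. exp (\<theta> * f n) < exp (\<theta> * Z)) sequentially"
      by (rule order_tendstoD(2)[OF lim]) simp
    then show "eventually (\<lambda>n. f n \<le> Z) sequentially"
      by eventually_elim (use assms(1) in simp)
  qed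
qed

lemma AE_walk_at_bot:
  assumes "q 1 + q (-1) < 0"
  shows "AE \<xi> in expos. \<forall>i\<in>{-1, 1}. filterlim (walk q i \<xi>) at_bot sequentially"
proof -
  obtain \<theta> where \<theta>: "0 < \<theta>"
    "\<And>i. i \<in> {-1, 1} \<Longrightarrow> AE \<xi> in expos. summable (\<lambda>n. exp (\<theta> * walk q i \<xi> n))"
    using AE_summable_exp_walk[of q] assms by metis
  have "AE \<xi> in expos. filterlim (walk q i \<xi>) at_bot sequentially" if "i \<in> {-1, 1}" for i
    using \<theta>(2)[OF that] by eventually_elim (rule filterlim_at_bot_of_summable_exp[OF \<theta>(1)])
  then show ?thesis by (intro AE_ball_countable') auto
qed

lemma AE_walk_at_top:
  assumes "0 < q 1 + q (-1)"
  shows "AE \<xi> in expos. \<forall>i\<in>{-1, 1}. filterlim (walk q i \<xi>) at_top sequentially"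
proof -
  have "AE \<xi> in expos. \<forall>i\<in>{-1, 1}. filterlim (walk (\<lambda>j. - q j) i \<xi>) at_bot sequentially"
    using assms by (intro AE_walk_at_bot) simp
  then show ?thesis
    by eventually_elim (simp add: walk_uminus filterlim_uminus_at_top)
qed

section \<open>The total integral\<close>

context switching
begin

text \<open>Written as a series, the total integral is measurable without any convergence argument;
  where the series diverges the value carries no meaning.\<close>

definition Jlim :: "int \<Rightarrow> (nat \<Rightarrow> real) \<Rightarrow> real" where
  "Jlim i \<xi> = (\<Sum>k. (exp (2 * walk slope i \<xi> (Suc k)) - exp (2 * walk slope i \<xi> k)) / drift ((-1) ^ k * i))"

lemma borel_measurable_J [measurable]: "(\<lambda>\<xi>. J i \<xi> n) \<in> borel_measurable expos"
  unfolding J_def by measurable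

lemma borel_measurable_Jlim [measurable]: "Jlim i \<in> borel_measurable expos"
  unfolding Jlim_def by measurable

lemma Jlim_eq: "J i \<xi> \<longlonglongrightarrow> L \<Longrightarrow> Jlim i \<xi> = L"
  unfolding Jlim_def J_def by (intro sums_unique[symmetric]) (simp add: sums_def)

lemma slope_pos: "0 < slope 1" and slope_neg: "slope (-1) < 0"
  using pm pp lm lp by (auto simp: slope_def drift_def rate_def divide_neg_pos)

lemma slope_nz [simp]: "slope i \<noteq> 0"
  using rate_pos[of i] by (simp add: slope_def less_imp_neq[symmetric])

lemma slope_sum_neg_iff: "slope 1 + slope (-1) < 0 \<longleftrightarrow> - (lm / pm) < lp / pp"
  using pm pp lm lp by (auto simp: slope_def drift_def rate_def field_simps)

lemma slope_sum_pos_iff: "0 < slope 1 + slope (-1) \<longleftrightarrow> lp / pp < - (lm / pm)"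
  using pm pp lm lp by (auto simp: slope_def drift_def rate_def field_simps)

text \<open>The first holding interval contributes
  \<open>(exp (2 * slope i * s) - 1) / drift i\<close>; what follows is the integral for the shifted
  chain, scaled by \<open>exp (2 * slope i * s)\<close>. For a fixed tail this is an explicit
  function of \<open>s\<close>.\<close>

lemma J_case_nat:
  "J i (case_nat s \<omega>) (Suc n) = exp (2 * slope i * s) * (J (- i) \<omega> n + 1 / drift i) - 1 / drift i"
proof (induction n)
  case 0
  show ?case by (simp add: J_Suc walk_case_nat diff_divide_distrib)
next
  case (Suc n)
  have e: "exp (2 * walk slope i (case_nat s \<omega>) (Suc m)) = exp (2 * slope i * s) * exp (2 * walk slope (- i) \<omega> m)" for m
    by (simp add: walk_case_nat exp_add[symmetric] algebra_simps)
  show ?case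
    unfolding J_Suc[of i _ "Suc n"] J_Suc[of "- i" _ n] Suc e
    by (simp add: algebra_simps diff_divide_distrib)
qed

lemma Jlim_case_nat:
  assumes "J (- i) \<omega> \<longlonglongrightarrow> Jlim (- i) \<omega>"
  shows "Jlim i (case_nat s \<omega>) = exp (2 * slope i * s) * (Jlim (- i) \<omega> + 1 / drift i) - 1 / drift i"
proof (rule Jlim_eq, rule LIMSEQ_imp_Suc)
  show "(\<lambda>n. J i (case_nat s \<omega>) (Suc n)) \<longlonglongrightarrow> exp (2 * slope i * s) * (Jlim (- i) \<omega> + 1 / drift i) - 1 / drift i"
    unfolding J_case_nat by (intro tendsto_intros assms)
qed

text \<open>Eventually \<open>A\<close> is at most 0, and there \<theta> \<le> 1 gives
  \<open>exp (2 * A)\<close> \<le> \<open>exp (\<theta> * A)\<close>, which is summable.\<close>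

lemma J_convergent:
  assumes s: "summable (\<lambda>n. exp (\<theta> * walk slope i \<xi> n))" and \<theta>: "0 < \<theta>" "\<theta> \<le> 1"
  shows "J i \<xi> \<longlonglongrightarrow> Jlim i \<xi>"
proof -
  let ?A = "walk slope i \<xi>"
  have "eventually (\<lambda>n. ?A n \<le> 0) sequentially"
    using filterlim_at_bot_of_summable_exp[OF \<theta>(1) s] unfolding filterlim_at_bot by blast
  then have "eventually (\<lambda>n. norm (exp (2 * ?A n)) \<le> exp (\<theta> * ?A n)) sequentially"
    by eventually_elim (use \<theta> in \<open>auto intro: mult_right_mono_neg\<close>)
  then have e: "summable (\<lambda>n. exp (2 * ?A n))"
    using s by (rule summable_comparison_test_ev)
  have inv: "1 / \<bar>drift j\<bar> \<le> 1 / pp + 1 / (- pm)" for j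
    using pm pp by (auto simp: drift_def)
  have bound: "norm ((exp (2 * ?A (Suc n)) - exp (2 * ?A n)) / drift ((-1) ^ n * i))
      \<le> (exp (2 * ?A (Suc n)) + exp (2 * ?A n)) * (1 / pp + 1 / (- pm))" for n
  proof -
    have "norm ((exp (2 * ?A (Suc n)) - exp (2 * ?A n)) / drift ((-1) ^ n * i))
        = \<bar>exp (2 * ?A (Suc n)) - exp (2 * ?A n)\<bar> * (1 / \<bar>drift ((-1) ^ n * i)\<bar>)"
      by (simp add: abs_divide)
    also have "\<dots> \<le> (exp (2 * ?A (Suc n)) + exp (2 * ?A n)) * (1 / pp + 1 / (- pm))"
      by (intro mult_mono inv) (auto simp: abs_le_iff add_increasing add_increasing2)
    finally show ?thesis .
  qed
  have "summable (\<lambda>n. (exp (2 * ?A (Suc n)) + exp (2 * ?A n)) * (1 / pp + 1 / (- pm)))"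
    using e summable_Suc_iff[of "\<lambda>n. exp (2 * ?A n)"] by (intro summable_mult2 summable_add) simp_all
  then have "summable (\<lambda>n. (exp (2 * ?A (Suc n)) - exp (2 * ?A n)) / drift ((-1) ^ n * i))"
    by (rule summable_comparison_test'[where N = 0]) (rule bound)
  then show ?thesis
    unfolding J_def[abs_def] Jlim_def by (rule summable_LIMSEQ)
qed

end

locale switching_neg = switching +
  assumes slope_sum: "slope 1 + slope (-1) < 0"
begin

lemma AE_J_convergent: "i \<in> {-1, 1} \<Longrightarrow> AE \<xi> in expos. J i \<xi> \<longlonglongrightarrow> Jlim i \<xi>"
proof -
  assume i: "i \<in> {-1, 1}"
  obtain \<theta> where \<theta>: "0 < \<theta>" "\<theta> \<le> 1"
    "\<And>i. i \<in> {-1, 1} \<Longrightarrow> AE \<xi> in expos. summable (\<lambda>n. exp (\<theta> * walk slope i \<xi> n))"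
    using AE_summable_exp_walk[of slope] slope_sum by metis
  show ?thesis
    using \<theta>(3)[OF i] by eventually_elim (rule J_convergent[OF _ \<theta>(1,2)])
qed

lemma AE_Jlim_nonneg:
  assumes "i \<in> {-1, 1}"
  shows "AE \<xi> in expos. 0 \<le> Jlim i \<xi>"
  using AE_J_convergent[OF assms] AE_expos_pos
proof eventually_elim
  fix \<xi> assume lim: "J i \<xi> \<longlonglongrightarrow> Jlim i \<xi>" and pos: "\<forall>k. 0 < \<xi> k"
  have "0 \<le> J i \<xi> n" for n
    using J_mono[of \<xi> 0 n i] pos by (simp add: less_imp_le)
  then show "0 \<le> Jlim i \<xi>" by (intro LIMSEQ_le_const[OF lim]) auto
qed

text \<open>For a fixed tail the total integral is an injective function of the first variable,
  except when the tail makes it constant, which \<open>prev\<close> excludes. So at most one value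
  of that variable leads to \<open>c\<close>.\<close>

lemma AE_Jlim_neq_step:
  assumes i: "i \<in> {-1, 1}" and prev: "AE \<omega> in expos. Jlim (- i) \<omega> \<noteq> - 1 / drift i"
  shows "AE \<xi> in expos. Jlim i \<xi> \<noteq> c"
proof (rule AE_expos_shiftI)
  have "AE \<omega> in expos. J (- i) \<omega> \<longlonglongrightarrow> Jlim (- i) \<omega>" using i by (intro AE_J_convergent) auto
  then show "AE \<omega> in expos. AE s in expo. Jlim i (case_nat s \<omega>) \<noteq> c"
    using prev
  proof eventually_elim
    fix \<omega> assume lim: "J (- i) \<omega> \<longlonglongrightarrow> Jlim (- i) \<omega>" and ne: "Jlim (- i) \<omega> \<noteq> - 1 / drift i"
    define y where "y = Jlim (- i) \<omega> + 1 / drift i"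
    have y: "y \<noteq> 0" using ne by (auto simp: y_def add_eq_0_iff2)
    show "AE s in expo. Jlim i (case_nat s \<omega>) \<noteq> c"
    proof (cases "\<exists>s0. Jlim i (case_nat s0 \<omega>) = c")
      case True
      then obtain s0 where s0: "Jlim i (case_nat s0 \<omega>) = c" by blast
      show ?thesis
        using AE_expo_neq[of s0]
      proof eventually_elim
        fix s assume "s \<noteq> s0"
        then show "Jlim i (case_nat s \<omega>) \<noteq> c"
          unfolding s0[symmetric] Jlim_case_nat[OF lim] y_def[symmetric] using y by simp
      qed
    qed auto
  qed
qed measurable

text \<open>The exceptional tail value for \<open>i = 1\<close> is negative, hence impossible for a
  nonnegative integral. This settles state 1 for every \<open>c\<close>, in particular for the
  exceptional value of state -1.\<close>

lemma AE_Jlim_neq: "i \<in> {-1, 1} \<Longrightarrow> AE \<xi> in expos. Jlim i \<xi> \<noteq> c"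
proof -
  have "AE \<omega> in expos. Jlim (- 1) \<omega> \<noteq> - 1 / drift 1"
  proof -
    have d: "- 1 / drift 1 < 0" using pp by (simp add: drift_def)
    have "AE \<omega> in expos. 0 \<le> Jlim (- 1) \<omega>" by (rule AE_Jlim_nonneg) simp
    then show ?thesis by eventually_elim (use d in linarith)
  qed
  then have 1: "AE \<xi> in expos. Jlim 1 \<xi> \<noteq> c" for c
    by (rule AE_Jlim_neq_step[rotated]) simp
  have "AE \<xi> in expos. Jlim (- (-1)) \<xi> \<noteq> - 1 / drift (-1)"
    using 1[of "- 1 / drift (-1)"] by simp
  then have "AE \<xi> in expos. Jlim (-1) \<xi> \<noteq> c"
    by (rule AE_Jlim_neq_step[rotated]) simp
  with 1 show "i \<in> {-1, 1} \<Longrightarrow> AE \<xi> in expos. Jlim i \<xi> \<noteq> c" by blast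
qed

text \<open>A first stay of length \<open>s\<close> in -1 damps the deviation of the total integral
  from \<open>- 1 / pm\<close> by a factor exponentially small in \<open>s\<close>. Staying above
  \<open>c\<close> regardless would force the tail integral to be infinite.\<close>

lemma Jlim_not_AE_ge_minus:
  assumes c: "- 1 / pm < c"
  shows "\<not> (AE \<xi> in expos. c \<le> Jlim (-1) \<xi>)"
proof
  assume "AE \<xi> in expos. c \<le> Jlim (-1) \<xi>"
  from AE_expos_shift[OF this]
  have sh: "AE s in expo. AE \<omega> in expos. c \<le> Jlim (-1) (case_nat s \<omega>)" .
  define \<eta> where "\<eta> = c + 1 / pm"
  define b where "b = - 2 * slope (-1)"
  have \<eta>: "0 < \<eta>" and b: "0 < b" using c slope_neg by (auto simp: \<eta>_def b_def)
  \<comment> \<open>Only countably many bounds are derived, one for each natural number, so that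
    they hold simultaneously almost surely.\<close>
  have "AE \<omega> in expos. \<eta> * exp (b * real K) \<le> Jlim 1 \<omega> + 1 / pm" for K :: nat
  proof -
    obtain s where s: "real K < s" and ae: "AE \<omega> in expos. c \<le> Jlim (-1) (case_nat s \<omega>)"
      using AE_expo_obtain[OF sh, of "real K" "real K + 1"] by auto
    have "AE \<omega> in expos. J 1 \<omega> \<longlonglongrightarrow> Jlim 1 \<omega>" by (intro AE_J_convergent) auto
    with ae show ?thesis
    proof eventually_elim
      fix \<omega> assume "c \<le> Jlim (-1) (case_nat s \<omega>)" and lim: "J 1 \<omega> \<longlonglongrightarrow> Jlim 1 \<omega>"
      then have "\<eta> \<le> exp (- (b * s)) * (Jlim 1 \<omega> + 1 / pm)"
        using Jlim_case_nat[of "-1" \<omega> s] by (simp add: \<eta>_def b_def drift_def)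
      then have "\<eta> * exp (b * s) \<le> Jlim 1 \<omega> + 1 / pm"
        by (simp add: exp_minus field_simps)
      moreover have "\<eta> * exp (b * real K) \<le> \<eta> * exp (b * s)"
        using s \<eta> b by simp
      ultimately show "\<eta> * exp (b * real K) \<le> Jlim 1 \<omega> + 1 / pm" by simp
    qed
  qed
  then have "AE \<omega> in expos. \<forall>K::nat. \<eta> * exp (b * real K) \<le> Jlim 1 \<omega> + 1 / pm"
    unfolding AE_all_countable by blast
  then have "AE \<omega> in expos. False"
  proof eventually_elim
    fix \<omega> assume *: "\<forall>K::nat. \<eta> * exp (b * real K) \<le> Jlim 1 \<omega> + 1 / pm"
    obtain K :: nat where K: "(Jlim 1 \<omega> + 1 / pm) / (\<eta> * b) < real K"
      using reals_Archimedean2 by blast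
    then have "Jlim 1 \<omega> + 1 / pm < \<eta> * (b * real K)"
      using \<eta> b by (simp add: field_simps)
    also have "\<dots> \<le> \<eta> * exp (b * real K)"
      using exp_ge_add_one_self[of "b * real K"] \<eta> by (intro mult_left_mono) linarith+
    finally show False using * by (simp add: not_le[symmetric])
  qed
  then show False by simp
qed

text \<open>A start in 1 is reduced to a start in -1 by a first holding time so short that the
  threshold only drops from \<open>c\<close> to \<open>c'\<close>.\<close>

lemma Jlim_not_AE_ge:
  assumes c: "- 1 / pm < c" and i: "i \<in> {-1, 1}"
  shows "\<not> (AE \<xi> in expos. c \<le> Jlim i \<xi>)"
proof (cases "i = 1")
  case True
  show ?thesis
  proof
    assume "AE \<xi> in expos. c \<le> Jlim i \<xi>"
    then have sh: "AE s in expo. AE \<omega> in expos. c \<le> Jlim 1 (case_nat s \<omega>)"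
      using AE_expos_shift[of "\<lambda>\<xi>. c \<le> Jlim 1 \<xi>"] True by simp
    \<comment> \<open>The midpoint of \<open>c\<close> and \<open>- 1 / pm\<close>; a growth factor
      below \<open>1 / \<rho>\<close> keeps the lowered threshold above
      \<open>- 1 / pm\<close>.\<close>
    define c' where "c' = (c - 1 / pm) / 2"
    define \<rho> where "\<rho> = (c' + 1 / pp) / (c + 1 / pp)"
    have c': "- 1 / pm < c'" "c' < c" using c by (auto simp: c'_def)
    have "0 < - 1 / pm" using pm by (simp add: divide_neg_neg)
    moreover have "0 < 1 / pp" using pp by simp
    ultimately have pos: "0 < c' + 1 / pp" "0 < c + 1 / pp" using c c' by linarith+
    then have \<rho>: "0 < \<rho>" "\<rho> < 1" using c' by (auto simp: \<rho>_def)
    have "0 < - ln \<rho> / (2 * slope 1)"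
      using \<rho> slope_pos by (intro divide_pos_pos) auto
    then obtain s where s: "0 < s" "s < - ln \<rho> / (2 * slope 1)"
      and ae: "AE \<omega> in expos. c \<le> Jlim 1 (case_nat s \<omega>)"
      using AE_expo_obtain[OF sh, of 0 "- ln \<rho> / (2 * slope 1)"] by blast
    have "2 * slope 1 * s < ln (1 / \<rho>)"
      using s slope_pos \<rho> by (simp add: ln_div field_simps)
    then have "exp (2 * slope 1 * s) < 1 / \<rho>"
      using \<rho> by (metis exp_less_cancel_iff exp_ln zero_less_divide_1_iff)
    then have bound: "exp (2 * slope 1 * s) * (c' + 1 / pp) \<le> c + 1 / pp"
      using pos by (simp add: \<rho>_def field_simps)
    have "AE \<omega> in expos. J (-1) \<omega> \<longlonglongrightarrow> Jlim (-1) \<omega>" by (intro AE_J_convergent) auto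
    with ae have "AE \<omega> in expos. c' \<le> Jlim (-1) \<omega>"
    proof eventually_elim
      fix \<omega> assume "c \<le> Jlim 1 (case_nat s \<omega>)" and lim: "J (-1) \<omega> \<longlonglongrightarrow> Jlim (-1) \<omega>"
      then have "c + 1 / pp \<le> exp (2 * slope 1 * s) * (Jlim (-1) \<omega> + 1 / pp)"
        using Jlim_case_nat[of 1 \<omega> s] by (simp add: drift_def)
      with bound have "exp (2 * slope 1 * s) * (c' + 1 / pp) \<le> exp (2 * slope 1 * s) * (Jlim (-1) \<omega> + 1 / pp)"
        by linarith
      then show "c' \<le> Jlim (-1) \<omega>" by simp
    qed
    with Jlim_not_AE_ge_minus[OF c'(1)] show False by blast
  qed
qed (use Jlim_not_AE_ge_minus[OF c] i in auto)

end

context switching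
begin

text \<open>One long stay in 1 already pushes the integral beyond any \<open>c\<close>, whatever the
  sign of the mean drift.\<close>

lemma J_not_AE_bounded_plus: "\<not> (AE \<xi> in expos. \<forall>n. J 1 \<xi> n \<le> c)"
proof
  assume "AE \<xi> in expos. \<forall>n. J 1 \<xi> n \<le> c"
  from AE_expos_shift[OF this]
  have sh: "AE s in expo. AE \<omega> in expos. \<forall>n. J 1 (case_nat s \<omega>) n \<le> c" .
  define u where "u = max 0 (c * pp / (2 * slope 1))"
  obtain s where s: "u < s" and ae: "AE \<omega> in expos. \<forall>n. J 1 (case_nat s \<omega>) n \<le> c"
    using AE_expo_obtain[OF sh, of u "u + 1"] by (auto simp: u_def)
  have "AE \<omega> in expos. (exp (2 * slope 1 * s) - 1) / pp \<le> c"
    using ae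
  proof eventually_elim
    fix \<omega> assume "\<forall>n. J 1 (case_nat s \<omega>) n \<le> c"
    from this[rule_format, of "Suc 0"] show "(exp (2 * slope 1 * s) - 1) / pp \<le> c"
      unfolding J_case_nat by (simp add: drift_def diff_divide_distrib)
  qed
  then have "(exp (2 * slope 1 * s) - 1) / pp \<le> c" by simp
  then have "exp (2 * slope 1 * s) - 1 \<le> c * pp" using pp by (simp add: field_simps)
  moreover have "1 + 2 * slope 1 * s \<le> exp (2 * slope 1 * s)" by simp
  moreover have "c * pp < 2 * slope 1 * s"
    using s slope_pos by (auto simp: u_def field_simps)
  ultimately show False by linarith
qed

text \<open>From -1, any typical first holding time transfers a bound to the chain started in 1, at
  the price of another constant.\<close>

lemma J_not_AE_bounded:
  assumes "i \<in> {-1, 1}"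
  shows "\<not> (AE \<xi> in expos. \<forall>n. J i \<xi> n \<le> c)"
proof (cases "i = 1")
  case False
  then have i: "i = -1" using assms by simp
  show ?thesis
  proof
    assume "AE \<xi> in expos. \<forall>n. J i \<xi> n \<le> c"
    from AE_expos_shift[OF this]
    have sh: "AE s in expo. AE \<omega> in expos. \<forall>n. J i (case_nat s \<omega>) n \<le> c" .
    obtain s where ae: "AE \<omega> in expos. \<forall>n. J i (case_nat s \<omega>) n \<le> c"
      using AE_expo_obtain[OF sh, of 0 1] by auto
    have "AE \<omega> in expos. \<forall>n. J 1 \<omega> n \<le> (c + 1 / pm) / exp (2 * slope i * s) - 1 / pm"
      using ae
    proof (eventually_elim, intro allI)
      fix \<omega> n assume "\<forall>n. J i (case_nat s \<omega>) n \<le> c"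
      from this[rule_format, of "Suc n"]
      have "exp (2 * slope i * s) * (J 1 \<omega> n + 1 / pm) \<le> c + 1 / pm"
        unfolding J_case_nat by (simp add: drift_def i)
      then have "J 1 \<omega> n + 1 / pm \<le> (c + 1 / pm) / exp (2 * slope i * s)"
        by (simp add: pos_le_divide_eq mult.commute)
      then show "J 1 \<omega> n \<le> (c + 1 / pm) / exp (2 * slope i * s) - 1 / pm" by simp
    qed
    with J_not_AE_bounded_plus show False by blast
  qed
qed (simp add: J_not_AE_bounded_plus)

end

section \<open>The law of the stopped process\<close>

text \<open>\<open>P\<close> need not be measurable, so the argument passes through a measurable
  null set outside which \<open>P\<close> holds.\<close>

lemma AE_pair_measure_snd:
  assumes "prob_space M1" "prob_space M2" and "AE y in M2. P y"
  shows "AE z in M1 \<Otimes>\<^sub>M M2. P (snd z)"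
proof -
  interpret M1: prob_space M1 by fact
  interpret M2: prob_space M2 by fact
  interpret pair_sigma_finite M1 M2 ..
  obtain N where N: "\<And>y. y \<in> space M2 - N \<Longrightarrow> P y" "N \<in> null_sets M2"
    using AE_E3[OF assms(3)] by blast
  have [measurable]: "N \<in> sets M2" using N(2) by auto
  have "AE z in M1 \<Otimes>\<^sub>M M2. snd z \<notin> N"
    using AE_not_in[OF N(2)] by (intro AE_pair_measure) auto
  then show ?thesis
    by (rule AE_mp) (use N(1) in \<open>auto simp: space_pair_measure intro!: AE_I2\<close>)
qed

locale switching_initial = switching +
  fixes \<nu> :: "(real \<times> int) measure"
  assumes prob_nu: "prob_space \<nu>" and sets_nu: "sets \<nu> = sets state_space"
    and nu_pos: "measure \<nu> ({0<..} \<times> {-1, 1}) = 1"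
begin

lemma measurable_fst_nu [measurable]: "fst \<in> borel_measurable \<nu>"
  unfolding measurable_cong_sets[OF sets_nu refl] state_space_def by (rule measurable_fst)

lemma measurable_snd_nu [measurable]: "snd \<in> measurable \<nu> (count_space UNIV)"
  unfolding measurable_cong_sets[OF sets_nu refl] state_space_def
  by (rule measurable_compose[OF measurable_snd measurable_count_space])

lemma AE_nu_pos: "AE p in \<nu>. 0 < fst p \<and> snd p \<in> {-1, 1}"
proof -
  interpret prob_space \<nu> by (rule prob_nu)
  have "{0<..} \<times> {-1, 1} \<in> sets \<nu>" by (auto simp: sets_nu state_space_def)
  then have "AE p in \<nu>. p \<in> {0<..} \<times> {-1, 1}" using AE_in_set_eq_1 nu_pos by blast
  then show ?thesis by eventually_elim auto
qed

end

sublocale switching_initial \<subseteq> nu_expos: pair_prob_space \<nu> expos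
proof -
  interpret prob_space \<nu> by (rule prob_nu)
  show "pair_prob_space \<nu> expos" ..
qed

locale stopped_switching = switching_initial +
  fixes a :: real and M :: "'w measure" and X :: "real \<Rightarrow> 'w \<Rightarrow> real" and E :: "real \<Rightarrow> 'w \<Rightarrow> int"
    and \<xi> :: "nat \<Rightarrow> 'w \<Rightarrow> real"
  assumes prob: "prob_space M"
    and E_meas: "\<And>t. 0 \<le> t \<Longrightarrow> E t \<in> measurable M (count_space {-1, 1})"
    and xi_meas [measurable]: "\<And>n. \<xi> n \<in> borel_measurable M"
    and law: "distr M (state_space \<Otimes>\<^sub>M Pi\<^sub>M UNIV (\<lambda>_. borel)) (\<lambda>\<omega>. ((X 0 \<omega>, E 0 \<omega>), \<lambda>n. \<xi> n \<omega>)) = \<nu> \<Otimes>\<^sub>M expos"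
    and chain: "AE \<omega> in M. \<forall>t\<ge>0. \<forall>n.
      jump_time lm lp (E 0 \<omega>) (\<lambda>k. \<xi> k \<omega>) n \<le> t \<and> t < jump_time lm lp (E 0 \<omega>) (\<lambda>k. \<xi> k \<omega>) (Suc n) \<longrightarrow>
      E t \<omega> = (-1) ^ n * E 0 \<omega>"
    and X_meas: "\<And>t. 0 \<le> t \<Longrightarrow> X t \<in> borel_measurable M"
    and X_cont: "\<And>\<omega>. \<omega> \<in> space M \<Longrightarrow> continuous_on {0..} (\<lambda>t. X t \<omega>)"
    and ode: "AE \<omega> in M. \<forall>t\<ge>0. ((\<lambda>s. vfield pm pp (E s \<omega>) (X s \<omega>)) has_integral (X t \<omega> - X 0 \<omega>))
      {0 .. real_of_ereal (min (ereal t) (hitting_time (\<lambda>s. X s \<omega>) a))}"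

lemma (in switching_initial) stopped_switching_processE:
  assumes "stopped_switching_process pm pp lm lp \<nu> a M X E"
  obtains \<xi> where "stopped_switching pm pp lm lp \<nu> a M X E \<xi>"
proof -
  have p: "prob_space M" and c: "switching_chain lm lp \<nu> M (X 0) E"
    and X: "\<forall>t\<ge>0. X t \<in> borel_measurable M" "\<forall>\<omega>\<in>space M. continuous_on {0..} (\<lambda>t. X t \<omega>)"
    and ode: "AE \<omega> in M. \<forall>t\<ge>0. ((\<lambda>s. vfield pm pp (E s \<omega>) (X s \<omega>)) has_integral (X t \<omega> - X 0 \<omega>))
      {0 .. real_of_ereal (min (ereal t) (hitting_time (\<lambda>s. X s \<omega>) a))}"
    using assms[unfolded stopped_switching_process_def] by blast+
  obtain \<xi> where \<xi>: "\<forall>t\<ge>0. E t \<in> measurable M (count_space {-1, 1})"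
    "\<forall>n. \<xi> n \<in> borel_measurable M"
    "distr M (state_space \<Otimes>\<^sub>M Pi\<^sub>M UNIV (\<lambda>_. borel)) (\<lambda>\<omega>. ((X 0 \<omega>, E 0 \<omega>), \<lambda>n. \<xi> n \<omega>)) = \<nu> \<Otimes>\<^sub>M expos"
    "AE \<omega> in M. \<forall>t\<ge>0. \<forall>n.
      jump_time lm lp (E 0 \<omega>) (\<lambda>k. \<xi> k \<omega>) n \<le> t \<and> t < jump_time lm lp (E 0 \<omega>) (\<lambda>k. \<xi> k \<omega>) (Suc n) \<longrightarrow>
      E t \<omega> = (-1) ^ n * E 0 \<omega>"
    using c unfolding switching_chain_def expo_def[symmetric] by (elim conjE exE) (rule that)
  show thesis
  proof (rule that, intro stopped_switching.intro stopped_switching_axioms.intro)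
    show "switching_initial pm pp lm lp \<nu>" ..
    show "E t \<in> measurable M (count_space {-1, 1})" if "0 \<le> t" for t using \<xi>(1) that by blast
    show "\<xi> n \<in> borel_measurable M" for n using \<xi>(2) by blast
    show "X t \<in> borel_measurable M" if "0 \<le> t" for t using X(1) that by blast
    show "continuous_on {0..} (\<lambda>t. X t \<omega>)" if "\<omega> \<in> space M" for \<omega> using X(2) that by blast
  qed (rule p \<xi>(3) \<xi>(4) ode)+
qed

context stopped_switching
begin

sublocale M: prob_space M by (rule prob)

abbreviation init :: "'w \<Rightarrow> (real \<times> int) \<times> (nat \<Rightarrow> real)" where
  "init \<omega> \<equiv> ((X 0 \<omega>, E 0 \<omega>), \<lambda>n. \<xi> n \<omega>)"

lemma init_measurable: "init \<in> measurable M (state_space \<Otimes>\<^sub>M Pi\<^sub>M UNIV (\<lambda>_. borel))"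
  unfolding state_space_def
  by (intro measurable_Pair X_meas E_meas measurable_PiM_single') auto

lemma AE_init:
  assumes "AE z in \<nu> \<Otimes>\<^sub>M expos. P z"
  shows "AE \<omega> in M. P (init \<omega>)"
  using assms unfolding law[symmetric] by (rule AE_distrD[OF init_measurable])

text \<open>Pushing an almost sure property forward to the product law requires its measurability,
  whereas \<open>AE_init\<close> pulls back without it. Fubini then freezes the initial
  state.\<close>

lemma AE_init_cases:
  assumes P: "{z \<in> space (\<nu> \<Otimes>\<^sub>M expos). P (fst z) (snd z)} \<in> sets (\<nu> \<Otimes>\<^sub>M expos)"
    and ae: "AE \<omega> in M. P (X 0 \<omega>, E 0 \<omega>) (\<lambda>n. \<xi> n \<omega>)"
  shows "AE p in \<nu>. AE y in expos. P p y"
proof -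
  have s: "sets (\<nu> \<Otimes>\<^sub>M expos) = sets (state_space \<Otimes>\<^sub>M Pi\<^sub>M UNIV (\<lambda>_. borel))"
    unfolding law[symmetric] by simp
  have "AE z in distr M (state_space \<Otimes>\<^sub>M Pi\<^sub>M UNIV (\<lambda>_. borel)) init. P (fst z) (snd z)"
    using P ae unfolding s sets_eq_imp_space_eq[OF s] by (subst AE_distr_iff[OF init_measurable]) auto
  then have "AE z in \<nu> \<Otimes>\<^sub>M expos. P (fst z) (snd z)" unfolding law .
  from nu_expos.AE_pair[OF this] show ?thesis by simp
qed

lemma E0: "\<omega> \<in> space M \<Longrightarrow> E 0 \<omega> \<in> {-1, 1}"
  using measurable_space[OF E_meas[of 0]] by simp

lemma AE_init_snd: "AE y in expos. P y \<Longrightarrow> AE \<omega> in M. P (\<lambda>n. \<xi> n \<omega>)"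
  using AE_init[OF AE_pair_measure_snd[OF prob_nu expos.prob_space_axioms, of P]] by simp

lemma AE_switched_path:
  "AE \<omega> in M. switched_path pm pp lm lp (E 0 \<omega>) (\<lambda>k. \<xi> k \<omega>) (\<lambda>t. X t \<omega>) (\<lambda>t. E t \<omega>) a"
proof -
  have "AE z in \<nu> \<Otimes>\<^sub>M expos. 0 < fst (fst z)"
    using AE_nu_pos by (intro nu_expos.AE_pair_measure) auto
  then have "AE \<omega> in M. 0 < X 0 \<omega>" using AE_init by force
  moreover have "AE \<omega> in M. \<forall>k. 0 < \<xi> k \<omega>"
    using AE_init_snd[OF AE_expos_pos] .
  moreover have "AE \<omega> in M. \<forall>i\<in>{-1, 1}. filterlim (jump_time lm lp i (\<lambda>n. \<xi> n \<omega>)) at_top sequentially"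
    unfolding jump_time_eq_walk by (intro AE_init_snd AE_walk_at_top add_pos_pos) simp_all
  ultimately show ?thesis
    using chain ode AE_space
  proof eventually_elim
    case (elim \<omega>)
    show ?case
    proof unfold_locales
      show "E 0 \<omega> \<in> {-1, 1}" using E0 elim by blast
      then show "filterlim (jump_time lm lp (E 0 \<omega>) (\<lambda>k. \<xi> k \<omega>)) at_top sequentially"
        using elim by blast
      show "0 < \<xi> k \<omega>" for k using elim by blast
      show "continuous_on {0..} (\<lambda>t. X t \<omega>)" using elim by (intro X_cont)
      show "0 < X 0 \<omega>" by (rule elim)
      show "E t \<omega> = (-1) ^ n * E 0 \<omega>" if "0 \<le> t" "jump_time lm lp (E 0 \<omega>) (\<lambda>k. \<xi> k \<omega>) n \<le> t"
        "t < jump_time lm lp (E 0 \<omega>) (\<lambda>k. \<xi> k \<omega>) (Suc n)" for t n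
        using elim that by blast
      show "((\<lambda>s. vfield pm pp (E s \<omega>) (X s \<omega>)) has_integral (X t \<omega> - X 0 \<omega>))
        {0 .. real_of_ereal (min (ereal t) (hitting_time (\<lambda>s. X s \<omega>) a))}" if "0 \<le> t" for t
        using elim that by blast
    qed
  qed
qed

lemma borel_measurable_hitting [measurable]:
  "(\<lambda>\<omega>. hitting_time (\<lambda>t. X t \<omega>) b) \<in> borel_measurable M"
  using X_meas X_cont by (rule borel_measurable_hitting_time)

text \<open>Never hitting would bound the integral by \<open>1 / (X 0 \<omega>)\<^sup>2\<close>,
  which for a frozen initial state contradicts \<open>J_not_AE_bounded\<close>.\<close>

lemma hitting_time_not_AE_infinite:
  assumes "sqrt (- pm) < b" "b \<le> a"
  shows "\<not> (AE \<omega> in M. hitting_time (\<lambda>t. X t \<omega>) b = \<infinity>)"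
proof
  assume "AE \<omega> in M. hitting_time (\<lambda>t. X t \<omega>) b = \<infinity>"
  with AE_switched_path have "AE \<omega> in M. \<forall>n. J (E 0 \<omega>) (\<lambda>k. \<xi> k \<omega>) n \<le> 1 / (X 0 \<omega>)\<^sup>2"
  proof eventually_elim
    fix \<omega> assume "switched_path pm pp lm lp (E 0 \<omega>) (\<lambda>k. \<xi> k \<omega>) (\<lambda>t. X t \<omega>) (\<lambda>t. E t \<omega>) a"
      and inf: "hitting_time (\<lambda>t. X t \<omega>) b = \<infinity>"
    then interpret p: switched_path pm pp lm lp "E 0 \<omega>" "\<lambda>k. \<xi> k \<omega>" "\<lambda>t. X t \<omega>" "\<lambda>t. E t \<omega>" a
      by simp
    have "hitting_time (\<lambda>t. X t \<omega>) a = \<infinity>"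
      using hitting_time_mono[OF assms(2), of "\<lambda>t. X t \<omega>"] inf by simp
    then show "\<forall>n. J (E 0 \<omega>) (\<lambda>k. \<xi> k \<omega>) n \<le> 1 / (X 0 \<omega>)\<^sup>2"
      using p.J_less_of_not_hitting by (auto intro: less_imp_le)
  qed
  \<comment> \<open>The random index \<open>E 0 \<omega>\<close> is replaced by a finite case
    distinction, so that only the measurability of \<open>J\<close> for fixed \<open>i\<close> is
    needed.\<close>
  then have "AE \<omega> in M. \<forall>i\<in>{-1, 1}. E 0 \<omega> = i \<longrightarrow> (\<forall>n. J i (\<lambda>k. \<xi> k \<omega>) n \<le> 1 / (X 0 \<omega>)\<^sup>2)"
    by eventually_elim auto
  then have "AE p in \<nu>. AE y in expos. \<forall>i\<in>{-1, 1}. snd p = i \<longrightarrow> (\<forall>n. J i y n \<le> 1 / (fst p)\<^sup>2)"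
    by (intro AE_init_cases[where P = "\<lambda>p y. \<forall>i\<in>{-1, 1}. snd p = i \<longrightarrow> (\<forall>n. J i y n \<le> 1 / (fst p)\<^sup>2)"])
      simp_all
  with AE_nu_pos have "AE p in \<nu>. False"
  proof eventually_elim
    fix p assume p: "0 < fst p \<and> snd p \<in> {-1, 1}"
      and ae: "AE y in expos. \<forall>i\<in>{-1, 1}. snd p = i \<longrightarrow> (\<forall>n. J i y n \<le> 1 / (fst p)\<^sup>2)"
    from ae have "AE y in expos. \<forall>n. J (snd p) y n \<le> 1 / (fst p)\<^sup>2"
      by eventually_elim (use p in auto)
    then show False using J_not_AE_bounded p by blast
  qed
  then show False using nu_expos.M1.AE_const by simp
qed

lemma AE_hitting_time_diff_less:
  assumes "sqrt (- pm) + 2 \<le> a"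
  shows "AE \<omega> in M. hitting_time (\<lambda>t. X t \<omega>) (sqrt (- pm) + 1) < \<infinity> \<longrightarrow>
    hitting_time (\<lambda>t. X t \<omega>) a - hitting_time (\<lambda>t. X t \<omega>) (a - 1) < ereal (2 / (a - 1 - sqrt (- pm))\<^sup>2)"
  using AE_switched_path
  by eventually_elim (blast intro: switched_path.hitting_time_diff_less[OF _ assms])

text \<open>\<open>A\<close> tends to infinity, and by \<open>J_ge\<close> so does the integral,
  which must then pass \<open>1 / (X 0 \<omega>)\<^sup>2\<close>.\<close>

lemma AE_hitting_time_finite:
  assumes pos: "0 < slope 1 + slope (-1)" and "b \<le> a"
  shows "AE \<omega> in M. hitting_time (\<lambda>t. X t \<omega>) b < \<infinity>"
proof -
  have "AE \<omega> in M. \<forall>i\<in>{-1, 1}. filterlim (walk slope i (\<lambda>n. \<xi> n \<omega>)) at_top sequentially"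
    by (intro AE_init_snd AE_walk_at_top pos)
  with AE_switched_path show ?thesis
  proof eventually_elim
    fix \<omega> assume "switched_path pm pp lm lp (E 0 \<omega>) (\<lambda>k. \<xi> k \<omega>) (\<lambda>t. X t \<omega>) (\<lambda>t. E t \<omega>) a"
      and top: "\<forall>i\<in>{-1, 1}. filterlim (walk slope i (\<lambda>n. \<xi> n \<omega>)) at_top sequentially"
    then interpret p: switched_path pm pp lm lp "E 0 \<omega>" "\<lambda>k. \<xi> k \<omega>" "\<lambda>t. X t \<omega>" "\<lambda>t. E t \<omega>" a
      by simp
    define c where "c = pp * (1 / (X 0 \<omega>)\<^sup>2)"
    have "filterlim p.A at_top sequentially" using top p.i by blast
    then obtain n where n: "c < p.A n"
      unfolding filterlim_at_top_dense eventually_sequentially by blast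
    have "0 \<le> c" using pp by (simp add: c_def)
    have "1 + 2 * p.A n \<le> exp (2 * p.A n)" by (rule exp_ge_add_one_self)
    then have "c < exp (2 * p.A n) - 1" using n \<open>0 \<le> c\<close> by linarith
    then have "1 / (X 0 \<omega>)\<^sup>2 < (exp (2 * p.A n) - 1) / pp"
      using pp by (simp add: c_def pos_less_divide_eq mult.commute)
    also have "\<dots> \<le> p.K n" using p.\<xi> by (intro J_ge) (simp add: less_imp_le)
    finally have "hitting_time (\<lambda>t. X t \<omega>) a \<noteq> \<infinity>"
      using p.J_less_of_not_hitting[of n] by auto
    then show "hitting_time (\<lambda>t. X t \<omega>) b < \<infinity>"
      using hitting_time_mono[OF assms(2), of "\<lambda>t. X t \<omega>"] by (auto simp: less_top[symmetric])
  qed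
qed

lemma AE_J_path:
  assumes neg: "slope 1 + slope (-1) < 0"
  shows "AE \<omega> in M. filterlim (walk slope (E 0 \<omega>) (\<lambda>n. \<xi> n \<omega>)) at_bot sequentially \<and>
    J (E 0 \<omega>) (\<lambda>n. \<xi> n \<omega>) \<longlonglongrightarrow> Jlim (E 0 \<omega>) (\<lambda>n. \<xi> n \<omega>)"
proof -
  interpret switching_neg pm pp lm lp by unfold_locales (rule neg)
  have "AE \<xi> in expos. \<forall>i\<in>{-1, 1}. J i \<xi> \<longlonglongrightarrow> Jlim i \<xi>"
    by (intro AE_ball_countable' AE_J_convergent) auto
  from AE_init_snd[OF this] AE_init_snd[OF AE_walk_at_bot[of slope, OF neg]] AE_space
  show ?thesis by eventually_elim (use E0 in blast)
qed

text \<open>A path that misses \<open>b\<close> also misses \<open>a\<close>, so its total integral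
  is at most \<open>1 / (X 0 \<omega>)\<^sup>2\<close>. Equality is almost surely impossible, and
  the strict inequality gives convergence to 0.\<close>

lemma AE_hitting_or_tendsto_0:
  assumes neg: "slope 1 + slope (-1) < 0" and b: "b \<le> a"
  shows "AE \<omega> in M. hitting_time (\<lambda>t. X t \<omega>) b < \<infinity> \<or> ((\<lambda>t. X t \<omega>) \<longlongrightarrow> 0) at_top"
proof -
  interpret switching_neg pm pp lm lp by unfold_locales (rule neg)
  have "AE p in \<nu>. AE y in expos. \<forall>i\<in>{-1, 1}. Jlim i y \<noteq> 1 / (fst p)\<^sup>2"
    by (intro AE_I2 AE_ball_countable' AE_Jlim_neq) auto
  then have "AE z in \<nu> \<Otimes>\<^sub>M expos. \<forall>i\<in>{-1, 1}. Jlim i (snd z) \<noteq> 1 / (fst (fst z))\<^sup>2"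
    by (intro nu_expos.AE_pair_measure) simp_all
  from AE_init[OF this] have "AE \<omega> in M. \<forall>i\<in>{-1, 1}. Jlim i (\<lambda>n. \<xi> n \<omega>) \<noteq> 1 / (X 0 \<omega>)\<^sup>2" by simp
  with AE_switched_path AE_J_path[OF neg] show ?thesis
  proof eventually_elim
    fix \<omega> assume "switched_path pm pp lm lp (E 0 \<omega>) (\<lambda>k. \<xi> k \<omega>) (\<lambda>t. X t \<omega>) (\<lambda>t. E t \<omega>) a"
      and lim: "filterlim (walk slope (E 0 \<omega>) (\<lambda>n. \<xi> n \<omega>)) at_bot sequentially \<and>
        J (E 0 \<omega>) (\<lambda>n. \<xi> n \<omega>) \<longlonglongrightarrow> Jlim (E 0 \<omega>) (\<lambda>n. \<xi> n \<omega>)"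
      and ne: "\<forall>i\<in>{-1, 1}. Jlim i (\<lambda>n. \<xi> n \<omega>) \<noteq> 1 / (X 0 \<omega>)\<^sup>2"
    then interpret p: switched_path pm pp lm lp "E 0 \<omega>" "\<lambda>k. \<xi> k \<omega>" "\<lambda>t. X t \<omega>" "\<lambda>t. E t \<omega>" a
      by simp
    let ?L = "Jlim (E 0 \<omega>) (\<lambda>n. \<xi> n \<omega>)"
    have "((\<lambda>t. X t \<omega>) \<longlongrightarrow> 0) at_top" if "\<not> hitting_time (\<lambda>t. X t \<omega>) b < \<infinity>"
    proof (rule p.tendsto_0_of_not_hitting)
      show inf: "hitting_time (\<lambda>t. X t \<omega>) a = \<infinity>"
        using hitting_time_mono[OF b, of "\<lambda>t. X t \<omega>"] that by simp
      show "filterlim p.A at_bot sequentially" using lim by blast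
      have "?L \<le> 1 / (X 0 \<omega>)\<^sup>2"
        using lim p.J_less_of_not_hitting[OF inf] by (intro LIMSEQ_le_const2[of p.K]) (auto intro: less_imp_le)
      moreover have "?L \<noteq> 1 / (X 0 \<omega>)\<^sup>2" using ne p.i by blast
      ultimately show "?L < 1 / (X 0 \<omega>)\<^sup>2" by simp
      have "incseq p.K" using p.\<xi> by (intro incseq_SucI J_mono) (auto intro: less_imp_le)
      then show "p.K n \<le> ?L" for n using lim by (intro incseq_le) auto
    qed
    then show "hitting_time (\<lambda>t. X t \<omega>) b < \<infinity> \<or> ((\<lambda>t. X t \<omega>) \<longlongrightarrow> 0) at_top" by blast
  qed
qed

text \<open>Almost sure hitting would put the total integral above
  \<open>1 / (fst p)\<^sup>2\<close> for almost every initial state \<open>p\<close>. Below the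
  equilibrium this threshold exceeds \<open>- 1 / pm\<close>, where \<open>Jlim_not_AE_ge\<close>
  forbids it.\<close>

lemma hitting_time_not_AE_finite:
  assumes neg: "slope 1 + slope (-1) < 0" and b: "sqrt (- pm) < b" "b \<le> a"
    and nu: "0 < measure \<nu> ({0<..<sqrt (- pm)} \<times> {-1, 1})"
  shows "\<not> (AE \<omega> in M. hitting_time (\<lambda>t. X t \<omega>) b < \<infinity>)"
proof
  interpret switching_neg pm pp lm lp by unfold_locales (rule neg)
  assume "AE \<omega> in M. hitting_time (\<lambda>t. X t \<omega>) b < \<infinity>"
  with AE_switched_path AE_J_path[OF neg]
  have "AE \<omega> in M. 1 / (X 0 \<omega>)\<^sup>2 < Jlim (E 0 \<omega>) (\<lambda>n. \<xi> n \<omega>)"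
  proof eventually_elim
    case (elim \<omega>)
    then show ?case
      using switched_path.less_J_limit_of_hitting[OF elim(1,3) b] by blast
  qed
  then have "AE \<omega> in M. \<forall>i\<in>{-1, 1}. E 0 \<omega> = i \<longrightarrow> 1 / (X 0 \<omega>)\<^sup>2 < Jlim i (\<lambda>k. \<xi> k \<omega>)"
    by eventually_elim auto
  then have "AE p in \<nu>. AE y in expos. \<forall>i\<in>{-1, 1}. snd p = i \<longrightarrow> 1 / (fst p)\<^sup>2 < Jlim i y"
    by (intro AE_init_cases[where P = "\<lambda>p y. \<forall>i\<in>{-1, 1}. snd p = i \<longrightarrow> 1 / (fst p)\<^sup>2 < Jlim i y"])
      simp_all
  with AE_nu_pos have "AE p in \<nu>. p \<notin> {0<..<sqrt (- pm)} \<times> {-1, 1}"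
  proof eventually_elim
    fix p assume p: "0 < fst p \<and> snd p \<in> {-1, 1}"
      and ae: "AE y in expos. \<forall>i\<in>{-1, 1}. snd p = i \<longrightarrow> 1 / (fst p)\<^sup>2 < Jlim i y"
    from ae have "AE y in expos. 1 / (fst p)\<^sup>2 \<le> Jlim (snd p) y"
      by eventually_elim (use p in \<open>auto intro: less_imp_le\<close>)
    then have "\<not> - 1 / pm < 1 / (fst p)\<^sup>2" using Jlim_not_AE_ge p by blast
    moreover have "- 1 / pm < 1 / (fst p)\<^sup>2" if "fst p < sqrt (- pm)"
    proof -
      have "(fst p)\<^sup>2 < (sqrt (- pm))\<^sup>2" using that p by (intro power_strict_mono) auto
      then have "(fst p)\<^sup>2 < - pm" using pm by simp
      then have "1 / (- pm) < 1 / (fst p)\<^sup>2" using p pm by (intro divide_strict_left_mono mult_pos_pos) auto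
      then show ?thesis by simp
    qed
    ultimately show "p \<notin> {0<..<sqrt (- pm)} \<times> {-1, 1}" by (auto simp: mem_Times_iff)
  qed
  moreover have "{0<..<sqrt (- pm)} \<times> {-1, 1} \<in> sets \<nu>" by (auto simp: sets_nu state_space_def)
  ultimately have "measure \<nu> ({0<..<sqrt (- pm)} \<times> {-1, 1}) = 0"
    by (intro measure_eq_0_null_sets) (simp add: AE_iff_null_sets)
  then show False using nu by simp
qed

end

section \<open>The integrable bound, and translation of almost sure statements into
  probabilities\<close>

lemma antimono_inverse_square: "antimono_on {r + 2..} (\<lambda>a::real. 2 / (a - 1 - r)\<^sup>2)"
proof (rule monotone_onI)
  fix a b :: real assume "a \<in> {r + 2..}" "b \<in> {r + 2..}" "a \<le> b"
  then show "2 / (b - 1 - r)\<^sup>2 \<le> 2 / (a - 1 - r)\<^sup>2"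
    by (intro divide_left_mono power_mono mult_pos_pos) auto
qed

lemma set_integrable_inverse_square: "set_integrable lborel {r + 2..} (\<lambda>a::real. 2 / (a - 1 - r)\<^sup>2)"
proof -
  have "(\<integral>\<^sup>+a. ennreal (2 / (a - 1 - r)\<^sup>2) * indicator {r + 2..} a \<partial>lborel) = ennreal (0 - (- 2 / (r + 2 - 1 - r)))"
  proof (rule nn_integral_FTC_atLeast)
    show "((\<lambda>a. - 2 / (a - 1 - r)) has_real_derivative 2 / (a - 1 - r)\<^sup>2) (at a)" if "r + 2 \<le> a" for a
      using that by (auto intro!: derivative_eq_intros simp: power2_eq_square)
    have "filterlim (\<lambda>a. - (1 + r) + a) at_top at_top"
      by (intro filterlim_tendsto_add_at_top[OF tendsto_const] filterlim_ident)
    then have "filterlim (\<lambda>a. a - 1 - r) at_top at_top" by (simp add: algebra_simps)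
    then show "((\<lambda>a. - 2 / (a - 1 - r)) \<longlongrightarrow> 0) at_top"
      by (intro tendsto_divide_0[OF tendsto_const] filterlim_at_top_imp_at_infinity)
  qed auto
  then have "(\<integral>\<^sup>+a. ennreal (indicator {r + 2..} a *\<^sub>R (2 / (a - 1 - r)\<^sup>2)) \<partial>lborel) < \<infinity>"
    by (subst nn_integral_cong[where v = "\<lambda>a. ennreal (2 / (a - 1 - r)\<^sup>2) * indicator {r + 2..} a"])
      (auto simp: indicator_def)
  then show ?thesis
    unfolding set_integrable_def by (intro integrableI_nonneg) auto
qed

context stopped_switching
begin

lemma sets_hitting_time_finite: "{\<omega> \<in> space M. hitting_time (\<lambda>t. X t \<omega>) b < \<infinity>} \<in> sets M"
  by measurable

lemma prob_hitting_time_pos: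
  assumes "sqrt (- pm) < b" "b \<le> a"
  shows "0 < \<P>(\<omega> in M. hitting_time (\<lambda>t. X t \<omega>) b < \<infinity>)"
proof (rule ccontr)
  assume "\<not> 0 < \<P>(\<omega> in M. hitting_time (\<lambda>t. X t \<omega>) b < \<infinity>)"
  then have "\<P>(\<omega> in M. hitting_time (\<lambda>t. X t \<omega>) b < \<infinity>) = 0"
    by (simp add: order_antisym not_less)
  then have "AE \<omega> in M. \<not> hitting_time (\<lambda>t. X t \<omega>) b < \<infinity>"
    using M.prob_Collect_eq_0[OF sets_hitting_time_finite] by blast
  then show False using hitting_time_not_AE_infinite[OF assms] by simp
qed

text \<open>The joint event agrees almost surely with the condition, and the condition has positive
  probability, so the defining quotient is 1 rather than the default value 0 of a division by
  0.\<close>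

lemma cond_prob_hitting_time_diff:
  assumes a: "sqrt (- pm) + 2 \<le> a"
  shows "\<P>(\<omega> in M. hitting_time (\<lambda>t. X t \<omega>) a - hitting_time (\<lambda>t. X t \<omega>) (a - 1)
      < ereal (2 / (a - 1 - sqrt (- pm))\<^sup>2) \<bar> hitting_time (\<lambda>t. X t \<omega>) (sqrt (- pm) + 1) < \<infinity>) = 1"
proof -
  let ?h = "\<lambda>b \<omega>. hitting_time (\<lambda>t. X t \<omega>) b"
  have "\<P>(\<omega> in M. ?h a \<omega> - ?h (a - 1) \<omega> < ereal (2 / (a - 1 - sqrt (- pm))\<^sup>2) \<and> ?h (sqrt (- pm) + 1) \<omega> < \<infinity>)
      = \<P>(\<omega> in M. ?h (sqrt (- pm) + 1) \<omega> < \<infinity>)"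
  proof (rule M.finite_measure_eq_AE)
    show "AE \<omega> in M. \<omega> \<in> {\<omega> \<in> space M. ?h a \<omega> - ?h (a - 1) \<omega> < ereal (2 / (a - 1 - sqrt (- pm))\<^sup>2)
        \<and> ?h (sqrt (- pm) + 1) \<omega> < \<infinity>} \<longleftrightarrow> \<omega> \<in> {\<omega> \<in> space M. ?h (sqrt (- pm) + 1) \<omega> < \<infinity>}"
      using AE_hitting_time_diff_less[OF a] by eventually_elim blast
  qed measurable
  then show ?thesis
    unfolding cond_prob_def using prob_hitting_time_pos[of "sqrt (- pm) + 1"] a by simp
qed

end

theorem theorem4p1:
  fixes pm pp lm lp :: real and \<nu> :: "(real \<times> int) measure"
  assumes "pm < 0" and "0 < pp" and "0 < lm" and "0 < lp"
    and "prob_space \<nu>" and "sets \<nu> = sets state_space"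
    and "measure \<nu> ({0<..} \<times> {-1, 1}) = 1"
  defines "r \<equiv> sqrt (- pm)"
  shows
    "(\<exists>g :: real \<Rightarrow> real.
        antimono_on {r + 2..} g \<and> (\<forall>a\<ge>r + 2. 0 < g a) \<and> set_integrable lborel {r + 2..} g \<and>
        (\<forall>a\<ge>r + 2. \<forall>(M :: 'w measure) X E.
           stopped_switching_process pm pp lm lp \<nu> a M X E \<longrightarrow>
             \<P>(\<omega> in M. hitting_time (\<lambda>t. X t \<omega>) (r + 1) < \<infinity>) > 0 \<and>
             \<P>(\<omega> in M. hitting_time (\<lambda>t. X t \<omega>) a - hitting_time (\<lambda>t. X t \<omega>) (a - 1) < ereal (g a)
                \<bar> hitting_time (\<lambda>t. X t \<omega>) (r + 1) < \<infinity>) = 1)) \<and>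
     (lp / pp < - (lm / pm) \<longrightarrow>
        (\<forall>a\<ge>r + 2. \<forall>(M :: 'w measure) X E.
           stopped_switching_process pm pp lm lp \<nu> a M X E \<longrightarrow>
             \<P>(\<omega> in M. hitting_time (\<lambda>t. X t \<omega>) (r + 1) < \<infinity>) = 1)) \<and>
     (lp / pp > - (lm / pm) \<and> measure \<nu> ({0<..<r} \<times> {-1, 1}) > 0 \<longrightarrow>
        (\<forall>a\<ge>r + 2. \<forall>(M :: 'w measure) X E.
           stopped_switching_process pm pp lm lp \<nu> a M X E \<longrightarrow>
             \<P>(\<omega> in M. hitting_time (\<lambda>t. X t \<omega>) (r + 1) < \<infinity>) < 1 \<and>
             \<P>(\<omega> in M. hitting_time (\<lambda>t. X t \<omega>) (r + 1) < \<infinity> \<or>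
                ((\<lambda>t. X t \<omega>) \<longlongrightarrow> 0) at_top) = 1))"
proof -
  interpret switching_initial pm pp lm lp \<nu>
    by (intro switching_initial.intro switching_initial_axioms.intro switching.intro assms)
  \<comment> \<open>Depends on \<open>pm\<close> only, so it can be fixed before the process is
    given.\<close>
  let ?g = "\<lambda>a. 2 / (a - 1 - r)\<^sup>2"
  have paths: thesis
    if "stopped_switching_process pm pp lm lp \<nu> a M X E"
      and "\<And>\<xi>. stopped_switching pm pp lm lp \<nu> a M X E \<xi> \<Longrightarrow> thesis"
    for a and M :: "'w measure" and X E thesis
    using stopped_switching_processE[OF that(1)] that(2) by blast
  show ?thesis
  proof (intro conjI impI allI exI[of _ ?g])
    show "antimono_on {r + 2..} ?g" by (rule antimono_inverse_square)
    show "set_integrable lborel {r + 2..} ?g" by (rule set_integrable_inverse_square)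
    show "0 < ?g a" if "r + 2 \<le> a" for a using that by simp
  next
    fix a and M :: "'w measure" and X E
    assume a: "r + 2 \<le> a" and "stopped_switching_process pm pp lm lp \<nu> a M X E"
    from this(2) obtain \<xi> where "stopped_switching pm pp lm lp \<nu> a M X E \<xi>" by (rule paths)
    then interpret stopped_switching pm pp lm lp \<nu> a M X E \<xi> .
    show "0 < \<P>(\<omega> in M. hitting_time (\<lambda>t. X t \<omega>) (r + 1) < \<infinity>)"
      using a unfolding r_def by (intro prob_hitting_time_pos) auto
    show "\<P>(\<omega> in M. hitting_time (\<lambda>t. X t \<omega>) a - hitting_time (\<lambda>t. X t \<omega>) (a - 1) < ereal (?g a)
        \<bar> hitting_time (\<lambda>t. X t \<omega>) (r + 1) < \<infinity>) = 1"
      using a unfolding r_def by (rule cond_prob_hitting_time_diff)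
  next
    fix a and M :: "'w measure" and X E
    assume lt: "lp / pp < - (lm / pm)"
      and a: "r + 2 \<le> a" and "stopped_switching_process pm pp lm lp \<nu> a M X E"
    from this(3) obtain \<xi> where "stopped_switching pm pp lm lp \<nu> a M X E \<xi>" by (rule paths)
    then interpret stopped_switching pm pp lm lp \<nu> a M X E \<xi> .
    show "\<P>(\<omega> in M. hitting_time (\<lambda>t. X t \<omega>) (r + 1) < \<infinity>) = 1"
      unfolding M.prob_Collect_eq_1[OF sets_hitting_time_finite]
      using lt a by (intro AE_hitting_time_finite) (auto simp: slope_sum_pos_iff)
  next
    fix a and M :: "'w measure" and X E
    assume gt: "- (lm / pm) < lp / pp \<and> 0 < measure \<nu> ({0<..<r} \<times> {-1, 1})"
      and a: "r + 2 \<le> a" and "stopped_switching_process pm pp lm lp \<nu> a M X E"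
    from this(3) obtain \<xi> where "stopped_switching pm pp lm lp \<nu> a M X E \<xi>" by (rule paths)
    then interpret stopped_switching pm pp lm lp \<nu> a M X E \<xi> .
    have neg: "slope 1 + slope (-1) < 0" using gt by (simp only: slope_sum_neg_iff)
    have "\<P>(\<omega> in M. hitting_time (\<lambda>t. X t \<omega>) (r + 1) < \<infinity>) \<noteq> 1"
      unfolding M.prob_Collect_eq_1[OF sets_hitting_time_finite]
      using gt a unfolding r_def by (intro hitting_time_not_AE_finite[OF neg]) auto
    then show "\<P>(\<omega> in M. hitting_time (\<lambda>t. X t \<omega>) (r + 1) < \<infinity>) < 1"
      using M.prob_le_1 by (simp add: order_less_le)
    have "{\<omega> \<in> space M. hitting_time (\<lambda>t. X t \<omega>) (r + 1) < \<infinity> \<or> ((\<lambda>t. X t \<omega>) \<longlongrightarrow> 0) at_top} \<in> sets M"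
      by (intro sets.sets_Collect_disj sets_hitting_time_finite sets_tendsto_0 X_meas X_cont)
    from M.prob_Collect_eq_1[OF this]
    show "\<P>(\<omega> in M. hitting_time (\<lambda>t. X t \<omega>) (r + 1) < \<infinity> \<or> ((\<lambda>t. X t \<omega>) \<longlongrightarrow> 0) at_top) = 1"
      using a AE_hitting_or_tendsto_0[OF neg, of "r + 1"] by simp
  qed
qed

end
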